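(* For every $K>0$ there are constants $N_0,k_0,\varepsilon_0,C,c>0$ such that the following holds for all integers $N\ge N_0$ and $k\ge k_0$, every $0<\varepsilon\le\varepsilon_0$, and every unitary matrix $M\in\mathbb{C}^{N\times N}$ satisfying $\max_{i,j}|M_{i,j}|\le K/\sqrt{N}$. For some positive integer $q\le C\cdot\log^2(1/\varepsilon)\cdot\varepsilon^{-2}\cdot k\cdot\log^2(k/\varepsilon)\cdot\log N$, let $A\in\mathbb{C}^{q\times N}$ be the random matrix whose $q$ rows are chosen uniformly and independently from the rows of $M$ and multiplied by $\sqrt{N/q}$. Then, with probability at least $1-2^{-c\cdot\log N\cdot\log(k/\varepsilon)}$, the matrix $A$ satisfies the restricted isometry property of order $k$ with constant $\varepsilon$.
   Context: A vector $x\in\mathbb{C}^N$ is $k$-sparse if it has at most $k$ nonzero entries. A matrix $A\in\mathbb{C}^{q\times N}$ satisfies the restricted isometry property of order $k$ with constant $\varepsilon$ if for every $k$-sparse vector $x\in\mathbb{C}^N$, $(1-\varepsilon)\|x\|_2^2\le\|Ax\|_2^2\le(1+\varepsilon)\|x\|_2^2$. The rows are chosen with replacement. *)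

theory Defs
  imports "HOL-Probability.Product_PMF" "Jordan_Normal_Form.Schur_Decomposition"
begin

unbundle no vec_syntax

definition unitary_mat :: "nat \<Rightarrow> complex mat \<Rightarrow> bool" where
  "unitary_mat n M \<longleftrightarrow>
     M \<in> carrier_mat n n \<and> M * mat_adjoint M = 1\<^sub>m n \<and> mat_adjoint M * M = 1\<^sub>m n"

definition l2_norm :: "complex Matrix.vec \<Rightarrow> real" where
  "l2_norm x = L2_set (\<lambda>i. cmod (x $ i)) {..<dim_vec x}"

definition sparse :: "nat \<Rightarrow> complex Matrix.vec \<Rightarrow> bool" where
  "sparse k x \<longleftrightarrow> card {i. i < dim_vec x \<and> x $ i \<noteq> 0} \<le> k"

definition restricted_isometry :: "nat \<Rightarrow> real \<Rightarrow> complex mat \<Rightarrow> bool" where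
  "restricted_isometry k \<epsilon> A \<longleftrightarrow>
     (\<forall>x \<in> carrier_vec (dim_col A). sparse k x \<longrightarrow>
        (1 - \<epsilon>) * (l2_norm x)\<^sup>2 \<le> (l2_norm (A *\<^sub>v x))\<^sup>2 \<and>
        (l2_norm (A *\<^sub>v x))\<^sup>2 \<le> (1 + \<epsilon>) * (l2_norm x)\<^sup>2)"

(* The factor is sqrt (N / q) for an N x N matrix M; the indices r i may repeat. *)
definition scaled_row_selection :: "nat \<Rightarrow> complex mat \<Rightarrow> (nat \<Rightarrow> nat) \<Rightarrow> complex mat" where
  "scaled_row_selection q M r =
     mat q (dim_col M)
       (\<lambda>(i, j). complex_of_real (sqrt (real (dim_col M) / real q)) * M $$ (r i, j))"

(* The law of the random matrix: the row indices are independent and uniform on the rows of M,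
   i.e. sampling is with replacement.  The default value 0 of Pi_pmf lies outside the
   q sampled coordinates and is never used. *)
definition subsampled_mat_pmf :: "nat \<Rightarrow> complex mat \<Rightarrow> complex mat pmf" where
  "subsampled_mat_pmf q M =
     map_pmf (scaled_row_selection q M) (Pi_pmf {..<q} 0 (\<lambda>_. pmf_of_set {..<dim_row M}))"

end

theory Submission
  imports Defs
begin

text \<open>
  Normalise the rows to have entries of modulus at most 1 and the sparse vector to have
  \<open>\<ell>\<^sub>1\<close>-norm at most 1; the claim becomes that the energy \<open>|y|\<^sup>2\<close>, \<open>y = A x\<close>, has nearly the same
  mean over the sampled rows as over all rows. Split \<open>|y|\<^sup>2\<close> into layers, the \<open>i\<close>-th one living where
  \<open>|y| > 2\<^sup>-\<^sup>i\<^sup>-\<^sup>1\<close>. By Maurey's empirical method \<open>y\<close> is within \<open>2\<^sup>-\<^sup>n / 4\<close> of an average of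
  \<open>O(4\<^sup>n log (k/\<epsilon>))\<close> columns, outside a small fraction of both the sampled and all rows. Each layer is
  chained along these approximations for \<open>n = i, i + 1, \<dots>, i + O(log (1/\<epsilon>))\<close>. A chain increment is
  bounded by \<open>O(2\<^sup>-\<^sup>i\<^sup>-\<^sup>n)\<close> and is supported where \<open>|y| > 2\<^sup>-\<^sup>i / 4\<close>, so Bernstein's inequality beats a
  union bound over all pairs of averages, at the cost of an error proportional to the energy of the layer.
  Since the averages may depend on the sample, no factor \<open>log q\<close> arises.
\<close>

section \<open>Concentration and Maurey approximation\<close>

lemma exp_le_quadratic:
  fixes y :: real
  assumes "\<bar>y\<bar> \<le> 1"
  shows "exp y \<le> 1 + y + y\<^sup>2"
proof (cases "y \<ge> 0")
  case True
  then show ?thesis using exp_bound[of y] assms by simp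
next
  case False
  define z where "z = - y"
  have z: "0 < z" "z \<le> 1" using False assms by (auto simp: z_def)
  have "1 + z + z\<^sup>2 / 2 \<le> exp z"
    using exp_lower_Taylor_quadratic[of z] z by simp
  moreover have "0 < 1 + z + z\<^sup>2 / 2" using z by (simp add: add_pos_pos)
  ultimately have "1 / exp z \<le> 1 / (1 + z + z\<^sup>2 / 2)" by (intro divide_left_mono) auto
  then have "exp y \<le> 1 / (1 + z + z\<^sup>2 / 2)"
    unfolding z_def by (simp only: exp_minus divide_inverse inverse_inverse_eq mult_1_left)
  also have "\<dots> \<le> 1 - z + z\<^sup>2"
  proof -
    \<comment> \<open>After clearing the denominator, this is the excess of the product over
      1.\<close>
    have "0 \<le> z\<^sup>2 * (1 + z + z\<^sup>2) / 2" using z by simp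
    also have "z\<^sup>2 * (1 + z + z\<^sup>2) / 2 = (1 - z + z\<^sup>2) * (1 + z + z\<^sup>2 / 2) - 1"
      by (simp add: power2_eq_square field_simps)
    finally have "1 \<le> (1 - z + z\<^sup>2) * (1 + z + z\<^sup>2 / 2)" by simp
    moreover have "0 < 1 + z + z\<^sup>2 / 2" using z by (simp add: add_pos_pos)
    ultimately show ?thesis by (simp add: divide_le_eq)
  qed
  finally show ?thesis by (simp add: z_def)
qed

text \<open>Chernoff's method with \<open>\<theta> = 2 * kap / lam\<close>. The hypothesis
  \<open>lin\<close> keeps \<open>\<theta> * X\<close> in the range where the exponential is below
  its quadratic majorant, and \<open>quad\<close> makes the second-order term at most
  \<open>kap\<close>; the exponent per draw is then \<open>kap - \<theta> * lam = - kap\<close>. The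
  two regimes of Bernstein's inequality thus appear as two conditions on the rate
  \<open>kap\<close>.\<close>

lemma bernstein_Pi_pmf_upper:
  fixes p :: "'a pmf" and X :: "'a \<Rightarrow> real"
  assumes fin: "finite (set_pmf p)"
    and bound: "\<And>x. x \<in> set_pmf p \<Longrightarrow> \<bar>X x\<bar> \<le> b"
    and var: "measure_pmf.expectation p (\<lambda>x. (X x)\<^sup>2) \<le> v"
    and lam: "0 < lam" and kap: "0 \<le> kap"
    and quad: "4 * v * kap \<le> lam\<^sup>2" and lin: "2 * b * kap \<le> lam"
  shows "measure_pmf.prob (Pi_pmf {..<m} d (\<lambda>_. p))
           {r. real m * (measure_pmf.expectation p X + lam) \<le> (\<Sum>t<m. X (r t))}
         \<le> exp (- real m * kap)"
proof -
  define \<theta> where "\<theta> = 2 * kap / lam"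
  define \<mu> where "\<mu> = measure_pmf.expectation p X"
  let ?P = "Pi_pmf {..<m} d (\<lambda>_. p)"
  let ?Y = "\<lambda>r. \<Prod>t<m. exp (\<theta> * X (r t))"
  have int: "integrable (measure_pmf p) f" for f :: "'a \<Rightarrow> real"
    using fin by (rule integrable_measure_pmf_finite)
  have \<theta>: "\<theta> \<ge> 0" using lam kap by (simp add: \<theta>_def)
  have \<theta>b: "\<theta> * b \<le> 1" using lin lam by (simp add: \<theta>_def field_simps)
  have \<theta>v: "\<theta>\<^sup>2 * v \<le> kap"
  proof -
    have "kap * (4 * v * kap) \<le> kap * lam\<^sup>2" using quad kap by (rule mult_left_mono)
    then show ?thesis using lam by (simp add: \<theta>_def field_simps power2_eq_square)
  qed
  have mgf: "measure_pmf.expectation p (\<lambda>x. exp (\<theta> * X x)) \<le> exp (\<theta> * \<mu> + kap)"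
  proof -
    have "measure_pmf.expectation p (\<lambda>x. exp (\<theta> * X x))
          \<le> measure_pmf.expectation p (\<lambda>x. 1 + \<theta> * X x + \<theta>\<^sup>2 * (X x)\<^sup>2)"
    proof (rule integral_mono_AE[OF int int], rule AE_pmfI)
      fix x assume "x \<in> set_pmf p"
      then have "\<bar>\<theta> * X x\<bar> \<le> \<theta> * b" using bound \<theta> by (simp add: abs_mult mult_left_mono)
      then have "\<bar>\<theta> * X x\<bar> \<le> 1" using \<theta>b by linarith
      from exp_le_quadratic[OF this] show "exp (\<theta> * X x) \<le> 1 + \<theta> * X x + \<theta>\<^sup>2 * (X x)\<^sup>2"
        by (simp add: power_mult_distrib)
    qed
    also have "\<dots> = 1 + \<theta> * \<mu> + \<theta>\<^sup>2 * measure_pmf.expectation p (\<lambda>x. (X x)\<^sup>2)"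
      by (simp add: int \<mu>_def)
    also have "\<dots> \<le> 1 + (\<theta> * \<mu> + kap)"
      using mult_left_mono[OF var, of "\<theta>\<^sup>2"] \<theta>v by simp
    also have "\<dots> \<le> exp (\<theta> * \<mu> + kap)" by (rule exp_ge_add_one_self)
    finally show ?thesis .
  qed
  have EY: "measure_pmf.expectation ?P ?Y
      = (\<Prod>t<m. measure_pmf.expectation p (\<lambda>x. exp (\<theta> * X x)))"
    by (rule expectation_prod_Pi_pmf) (auto simp: int)
  also have "\<dots> \<le> (\<Prod>t<m. exp (\<theta> * \<mu> + kap))"
    by (rule prod_mono) (auto intro!: mgf integral_nonneg_AE)
  also have "\<dots> = exp (real m * (\<theta> * \<mu> + kap))" by (simp add: exp_of_nat_mult)
  finally have EY_le: "measure_pmf.expectation ?P ?Y \<le> exp (real m * (\<theta> * \<mu> + kap))" .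
  have Y: "?Y r = exp (\<theta> * (\<Sum>t<m. X (r t)))" for r
    by (simp add: exp_sum sum_distrib_left)
  let ?c = "exp (\<theta> * (real m * (\<mu> + lam)))"
  have "measure_pmf.prob ?P {r. real m * (\<mu> + lam) \<le> (\<Sum>t<m. X (r t))}
      \<le> measure_pmf.prob ?P {r \<in> space (measure_pmf ?P). ?c \<le> ?Y r}"
    unfolding Y using \<theta> by (intro measure_pmf.finite_measure_mono) (auto intro: mult_left_mono)
  also have "\<dots> \<le> measure_pmf.expectation ?P ?Y / ?c"
    by (rule integral_Markov_inequality_measure[where A = "{}"])
       (auto intro!: integrable_prod_Pi_pmf int prod_nonneg)
  also have "\<dots> \<le> exp (real m * (\<theta> * \<mu> + kap)) / ?c"
    using EY_le by (simp add: divide_right_mono)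
  also have "\<dots> = exp (real m * (kap - \<theta> * lam))"
    by (simp add: exp_diff[symmetric] algebra_simps)
  also have "\<dots> = exp (- real m * kap)" using lam by (simp add: \<theta>_def)
  finally show ?thesis by (simp add: \<mu>_def)
qed

lemma prob_le_prob_Un:
  assumes "A \<subseteq> B \<union> C"
  shows "measure_pmf.prob p A \<le> measure_pmf.prob p B + measure_pmf.prob p C"
  using measure_pmf.finite_measure_mono[OF assms, of p] measure_Un_le[of B "measure_pmf p" C] by simp

lemma bernstein_Pi_pmf:
  fixes p :: "'a pmf" and X :: "'a \<Rightarrow> real"
  assumes fin: "finite (set_pmf p)"
    and bound: "\<And>x. x \<in> set_pmf p \<Longrightarrow> \<bar>X x\<bar> \<le> b"
    and var: "measure_pmf.expectation p (\<lambda>x. (X x)\<^sup>2) \<le> v"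
    and lam: "0 < lam" and kap: "0 \<le> kap"
    and quad: "4 * v * kap \<le> lam\<^sup>2" and lin: "2 * b * kap \<le> lam"
    and m: "0 < m"
  shows "measure_pmf.prob (Pi_pmf {..<m} d (\<lambda>_. p))
           {r. lam \<le> \<bar>(\<Sum>t<m. X (r t)) / real m - measure_pmf.expectation p X\<bar>}
         \<le> 2 * exp (- real m * kap)"
proof -
  let ?P = "Pi_pmf {..<m} d (\<lambda>_. p)"
  let ?A = "\<lambda>X. {r. real m * (measure_pmf.expectation p X + lam) \<le> (\<Sum>t<m. X (r t))}"
  have "{r. lam \<le> \<bar>(\<Sum>t<m. X (r t)) / real m - measure_pmf.expectation p X\<bar>}
      \<subseteq> ?A X \<union> ?A (\<lambda>x. - X x)"
    using m by (auto simp: field_simps sum_negf abs_if split: if_splits)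
  then have "measure_pmf.prob ?P {r. lam \<le> \<bar>(\<Sum>t<m. X (r t)) / real m - measure_pmf.expectation p X\<bar>}
      \<le> measure_pmf.prob ?P (?A X) + measure_pmf.prob ?P (?A (\<lambda>x. - X x))"
    by (rule prob_le_prob_Un)
  also have "\<dots> \<le> exp (- real m * kap) + exp (- real m * kap)"
    by (intro add_mono bernstein_Pi_pmf_upper[OF fin _ _ lam kap quad lin]) (use bound var in auto)
  finally show ?thesis by simp
qed

text \<open>The probabilistic method: draw \<open>m\<close> indices independently from
  \<open>p\<close>. Bernstein for the real and the imaginary part bounds the chance that a given
  \<open>j\<close> is missed, so the expected weight of the missed coordinates obeys the bound, and
  some draw does no worse than the mean. Averaging over \<open>J\<close> replaces a union bound, so
  the size of \<open>J\<close> does not enter.\<close>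

lemma maurey_approximation:
  fixes V :: "'t \<Rightarrow> 'j \<Rightarrow> complex" and \<mu> :: "'j \<Rightarrow> real"
  assumes fin: "finite (set_pmf p)" and J: "finite J"
    and \<mu>: "\<And>j. j \<in> J \<Longrightarrow> 0 \<le> \<mu> j"
    and V: "\<And>t j. t \<in> set_pmf p \<Longrightarrow> j \<in> J \<Longrightarrow> cmod (V t j) \<le> 2"
    and y: "\<And>j. j \<in> J \<Longrightarrow> y j = measure_pmf.expectation p (\<lambda>t. V t j)"
    and \<tau>: "0 < \<tau>" "\<tau> \<le> 1" and m: "0 < m"
  shows "\<exists>r \<in> {..<m} \<rightarrow>\<^sub>E set_pmf p.
     (\<Sum>j\<in>J. \<mu> j * of_bool (\<tau> < cmod ((\<Sum>t<m. V (r t) j) / of_nat m - y j)))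
       \<le> 4 * exp (- real m * (\<tau>\<^sup>2 / 64)) * (\<Sum>j\<in>J. \<mu> j)"
proof -
  \<comment> \<open>The default \<open>undefined\<close> makes the support exactly the extensional
    function space of the conclusion.\<close>
  let ?P = "Pi_pmf {..<m} undefined (\<lambda>_. p)"
  let ?Z = "\<lambda>r j. (\<Sum>t<m. V (r t) j) / of_nat m - y j"
  let ?b = "4 * exp (- real m * (\<tau>\<^sup>2 / 64)) * (\<Sum>j\<in>J. \<mu> j)"
  let ?F = "\<lambda>r. \<Sum>j\<in>J. \<mu> j * of_bool (\<tau> < cmod (?Z r j)) :: real"
  have int: "integrable (measure_pmf p) f" for f :: "'t \<Rightarrow> complex"
    using fin by (rule integrable_measure_pmf_finite)
  have supp: "set_pmf ?P = PiE_dflt {..<m} undefined (\<lambda>_. set_pmf p)"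
    by (subst set_Pi_pmf) (simp_all add: comp_def)
  have finP: "finite (set_pmf ?P)"
    unfolding supp by (rule finite_PiE_dflt) (auto simp: fin)
  have intP: "integrable (measure_pmf ?P) f" for f :: "_ \<Rightarrow> real"
    using finP by (rule integrable_measure_pmf_finite)
  have tail: "measure_pmf.prob ?P {r. \<tau> < cmod (?Z r j)} \<le> 4 * exp (- real m * (\<tau>\<^sup>2 / 64))"
    if j: "j \<in> J" for j
  proof -
    have part: "measure_pmf.prob ?P
        {r. \<tau> / 2 \<le> \<bar>(\<Sum>t<m. f (V (r t) j)) / real m - measure_pmf.expectation p (\<lambda>t. f (V t j))\<bar>}
        \<le> 2 * exp (- real m * (\<tau>\<^sup>2 / 64))"
      if f: "\<And>z. \<bar>f z\<bar> \<le> cmod z" for f :: "complex \<Rightarrow> real"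
    \<comment> \<open>At threshold \<open>\<tau> / 2\<close> the variance condition holds with
      equality for the rate \<open>\<tau>\<^sup>2 / 64\<close>.\<close>
    proof (rule bernstein_Pi_pmf[where b = 2 and v = 4])
      have b: "\<bar>f (V t j)\<bar> \<le> 2" if "t \<in> set_pmf p" for t
        using f[of "V t j"] V[OF that j] by linarith
      then show "t \<in> set_pmf p \<Longrightarrow> \<bar>f (V t j)\<bar> \<le> 2" for t .
      have "measure_pmf.expectation p (\<lambda>t. (f (V t j))\<^sup>2) \<le> measure_pmf.expectation p (\<lambda>t. 4)"
      proof (rule integral_mono_AE, goal_cases)
        case 3
        show ?case
        proof (rule AE_pmfI)
          fix t assume "t \<in> set_pmf p"
          from power_mono[OF b[OF this], of 2] show "(f (V t j))\<^sup>2 \<le> 4" by simp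
        qed
      qed (auto intro: integrable_measure_pmf_finite fin)
      then show "measure_pmf.expectation p (\<lambda>t. (f (V t j))\<^sup>2) \<le> 4" by simp
      show "2 * 2 * (\<tau>\<^sup>2 / 64) \<le> \<tau> / 2"
        using mult_left_mono[OF \<tau>(2), of \<tau>] \<tau>(1) by (simp add: power2_eq_square)
    qed (use fin m \<tau> in \<open>auto simp: power2_eq_square\<close>)
    let ?A = "\<lambda>f. {r. \<tau> / 2 \<le> \<bar>(\<Sum>t<m. f (V (r t) j)) / real m - measure_pmf.expectation p (\<lambda>t. f (V t j))\<bar>}"
    have sub: "{r. \<tau> < cmod (?Z r j)} \<subseteq> ?A Re \<union> ?A Im"
    proof (rule subsetI, rule ccontr)
      fix r assume r: "r \<in> {r. \<tau> < cmod (?Z r j)}" and n: "r \<notin> ?A Re \<union> ?A Im"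
      have "Re (?Z r j) = (\<Sum>t<m. Re (V (r t) j)) / real m - measure_pmf.expectation p (\<lambda>t. Re (V t j))"
        "Im (?Z r j) = (\<Sum>t<m. Im (V (r t) j)) / real m - measure_pmf.expectation p (\<lambda>t. Im (V t j))"
        unfolding y[OF j] by (simp_all add: int Re_sum Im_sum flip: integral_Re integral_Im)
      with n have "\<bar>Re (?Z r j)\<bar> + \<bar>Im (?Z r j)\<bar> < \<tau>" by auto
      with cmod_le[of "?Z r j"] r show False by auto
    qed
    have "measure_pmf.prob ?P {r. \<tau> < cmod (?Z r j)}
        \<le> measure_pmf.prob ?P (?A Re) + measure_pmf.prob ?P (?A Im)"
      using sub by (rule prob_le_prob_Un)
    also have "\<dots> \<le> 2 * exp (- real m * (\<tau>\<^sup>2 / 64)) + 2 * exp (- real m * (\<tau>\<^sup>2 / 64))"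
      by (intro add_mono part abs_Re_le_cmod abs_Im_le_cmod)
    finally show ?thesis by simp
  qed
  have "measure_pmf.expectation ?P ?F
      = (\<Sum>j\<in>J. \<mu> j * measure_pmf.prob ?P {r. \<tau> < cmod (?Z r j)})"
  proof -
    have "measure_pmf.expectation ?P (\<lambda>r. of_bool (\<tau> < cmod (?Z r j)) :: real)
        = measure_pmf.prob ?P {r. \<tau> < cmod (?Z r j)}" for j
    proof -
      have "(\<lambda>r. of_bool (\<tau> < cmod (?Z r j)) :: real) = indicator {r. \<tau> < cmod (?Z r j)}"
        by (auto simp: indicator_def)
      then show ?thesis by simp
    qed
    then show ?thesis by (simp add: intP)
  qed
  also have "\<dots> \<le> (\<Sum>j\<in>J. \<mu> j * (4 * exp (- real m * (\<tau>\<^sup>2 / 64))))"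
    by (intro sum_mono mult_left_mono tail \<mu>)
  also have "\<dots> = ?b" by (simp add: sum_distrib_left sum_distrib_right mult_ac)
  finally have EF: "measure_pmf.expectation ?P ?F \<le> ?b" .
  \<comment> \<open>If every draw in the support exceeded the bound, so would the mean, since all
    masses there are positive.\<close>
  have "\<exists>r\<in>set_pmf ?P. ?F r \<le> ?b"
  proof (rule ccontr)
    assume "\<not> ?thesis"
    then have gt: "?b < ?F r" if "r \<in> set_pmf ?P" for r using that by force
    have "?b = (\<Sum>r\<in>set_pmf ?P. ?b * pmf ?P r)"
      using sum_pmf_eq_1[OF finP order_refl] by (simp flip: sum_distrib_left)
    also have "\<dots> < (\<Sum>r\<in>set_pmf ?P. ?F r * pmf ?P r)"
      by (intro sum_strict_mono finP set_pmf_not_empty mult_strict_right_mono gt)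
         (assumption | rule pmf_positive)+
    also have "\<dots> = measure_pmf.expectation ?P ?F"
      by (rule integral_measure_pmf_real[symmetric, OF finP])
    finally show False using EF by simp
  qed
  then show ?thesis by (auto simp: supp PiE_dflt_def PiE_def extensional_def)
qed

lemma pmf_with_weights_exists:
  fixes w :: "'a \<Rightarrow> real"
  assumes "finite I" "\<And>i. i \<in> I \<Longrightarrow> 0 \<le> w i" "(\<Sum>i\<in>I. w i) = 1"
  obtains p where "set_pmf p \<subseteq> I" "\<And>i. i \<in> I \<Longrightarrow> pmf p i = w i"
proof
  define f where "f i = (if i \<in> I then w i else 0)" for i
  have nn: "\<And>x. 0 \<le> f x" using assms by (simp add: f_def)
  have "(\<integral>\<^sup>+x. ennreal (f x) \<partial>count_space UNIV) = (\<Sum>i\<in>I. ennreal (f i))"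
    by (rule nn_integral_count_space'[OF assms(1)]) (auto simp: f_def)
  also have "\<dots> = 1" using assms by (simp add: f_def sum_ennreal)
  finally have one: "(\<integral>\<^sup>+x. ennreal (f x) \<partial>count_space UNIV) = 1" .
  show "set_pmf (embed_pmf f) \<subseteq> I"
    by (auto simp: set_embed_pmf[OF nn one] f_def)
  show "pmf (embed_pmf f) i = w i" if "i \<in> I" for i
    using that by (simp add: pmf_embed_pmf[OF nn one] f_def)
qed

context
  notes sum_mult_of_bool_eq [simp del] sum_of_bool_mult_eq [simp del] sum_of_bool_eq [simp del]
begin

section \<open>Layers and chaining\<close>

text \<open>Differences of squared truncations, rather than the square restricted to a dyadic band:
  they telescope and are Lipschitz, which chaining requires.\<close>

definition layer :: "nat \<Rightarrow> complex \<Rightarrow> real" where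
  "layer i z = (min ((1/2) ^ i) (cmod z))\<^sup>2 - (min ((1/2) ^ Suc i) (cmod z))\<^sup>2"

lemma layer_clamp:
  "layer i z = (max ((1/2) ^ Suc i) (min ((1/2) ^ i) (cmod z)))\<^sup>2 - ((1/2) ^ Suc i)\<^sup>2"
proof -
  have "(1/2 :: real) ^ Suc i \<le> (1/2) ^ i" by simp
  then show ?thesis unfolding layer_def min_def max_def by (smt (verit))
qed

lemma layer_nonneg: "0 \<le> layer i z"
  unfolding layer_clamp by (simp add: power_mono)

lemma layer_le: "layer i z \<le> (1/4) ^ i"
proof -
  have "(min ((1/2) ^ i) (cmod z))\<^sup>2 \<le> ((1/2) ^ i)\<^sup>2" by (rule power_mono) auto
  also have "((1/2) ^ i)\<^sup>2 = ((1/4) ^ i :: real)"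
    by (simp add: power2_eq_square flip: power_mult_distrib)
  finally show ?thesis unfolding layer_def by (smt (verit) zero_le_power2)
qed

lemma layer_eq_0:
  assumes "cmod z \<le> (1/2) ^ Suc i"
  shows "layer i z = 0"
proof -
  have "(1/2 :: real) ^ Suc i \<le> (1/2) ^ i" by simp
  then show ?thesis using assms unfolding layer_def min_def by (smt (verit))
qed

text \<open>By \<open>layer_clamp\<close> the layer is, up to a constant, the square of a clamped
  modulus that is 1-Lipschitz and at most \<open>(1/2) ^ i\<close>; a difference of squares
  factors.\<close>

lemma layer_lipschitz: "\<bar>layer i z - layer i w\<bar> \<le> 2 * (1/2) ^ i * cmod (z - w)"
proof -
  define P where "P z = max ((1/2) ^ Suc i) (min ((1/2) ^ i) (cmod z))" for z
  have c: "(1/2 :: real) ^ Suc i \<le> (1/2) ^ i" by simp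
  have P: "0 \<le> P z" "P z \<le> (1/2) ^ i" for z using c by (auto simp: P_def le_max_iff_disj)
  have "\<bar>layer i z - layer i w\<bar> = \<bar>(P z)\<^sup>2 - (P w)\<^sup>2\<bar>" by (simp add: layer_clamp P_def)
  also have "\<dots> = \<bar>P z - P w\<bar> * (P z + P w)"
    using P(1)[of z] P(1)[of w] by (simp add: power2_eq_square square_diff_square_factored abs_mult)
  also have "\<dots> \<le> cmod (z - w) * (2 * (1/2) ^ i)"
  proof (rule mult_mono)
    have "\<bar>P z - P w\<bar> \<le> \<bar>cmod z - cmod w\<bar>" unfolding P_def by linarith
    also have "\<dots> \<le> cmod (z - w)" by (rule norm_triangle_ineq3)
    finally show "\<bar>P z - P w\<bar> \<le> cmod (z - w)" .
    show "P z + P w \<le> 2 * (1/2) ^ i" using P(2)[of z] P(2)[of w] by simp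
  qed (use P(1)[of z] P(1)[of w] in auto)
  finally show ?thesis by (simp add: mult_ac)
qed

lemma sum_layer:
  assumes "cmod z \<le> 1"
  shows "\<bar>(cmod z)\<^sup>2 - (\<Sum>i<L. layer i z)\<bar> \<le> (1/4) ^ L"
proof -
  have "(\<Sum>i<L. layer i z) = (min ((1/2) ^ 0) (cmod z))\<^sup>2 - (min ((1/2) ^ L) (cmod z))\<^sup>2"
    unfolding layer_def by (rule sum_lessThan_telescope')
  then have "(cmod z)\<^sup>2 - (\<Sum>i<L. layer i z) = (min ((1/2) ^ L) (cmod z))\<^sup>2"
    using assms by (simp add: min_absorb2)
  also have "\<dots> \<le> ((1/2) ^ L)\<^sup>2" by (rule power_mono) auto
  also have "((1/2) ^ L)\<^sup>2 = ((1/4) ^ L :: real)"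
    by (simp add: power2_eq_square flip: power_mult_distrib)
  finally show ?thesis using \<open>_ = (min ((1/2) ^ L) (cmod z))\<^sup>2\<close> by simp
qed

text \<open>A geometric sum is comparable to its largest term. Splitting off \<open>i = 0\<close>
  leaves a quarter of the same sum with \<open>4 * T\<close> for \<open>T\<close>, hence the
  induction with \<open>T\<close> arbitrary; the cap at 1 pays for the split-off term.\<close>

lemma sum_quarter_powers_le:
  fixes T :: real
  assumes "0 \<le> T"
  shows "(\<Sum>i<L. (1/4 :: real) ^ i * of_bool ((1/4) ^ i \<le> T)) \<le> 4 / 3 * min T 1"
  using assms
proof (induction L arbitrary: T)
  case (Suc L)
  have "(\<Sum>i<Suc L. (1/4 :: real) ^ i * of_bool ((1/4) ^ i \<le> T))
      = of_bool (1 \<le> T) + 1/4 * (\<Sum>i<L. (1/4) ^ i * of_bool ((1/4) ^ i \<le> 4 * T))"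
    by (subst sum.lessThan_Suc_shift) (simp add: sum_distrib_left mult.assoc mult.commute[of T])
  also have "\<dots> \<le> of_bool (1 \<le> T) + 1/4 * (4/3 * min (4 * T) 1)"
  proof -
    have "(\<Sum>i<L. (1/4 :: real) ^ i * of_bool ((1/4) ^ i \<le> 4 * T)) \<le> 4 / 3 * min (4 * T) 1"
      by (rule Suc.IH) (use Suc.prems in simp)
    then show ?thesis by linarith
  qed
  also have "\<dots> \<le> 4 / 3 * min T 1" using Suc.prems by (auto simp: min_def)
  finally show ?case .
qed simp

lemma sum_quarter_powers: "(\<Sum>i<L. (1/4 :: real) ^ i) \<le> 4 / 3"
proof -
  have "(\<Sum>i<L. (1/4 :: real) ^ i) = (\<Sum>i<L. (1/4) ^ i * of_bool ((1/4 :: real) ^ i \<le> 1))"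
    by (intro sum.cong) (auto simp: power_le_one)
  also have "\<dots> \<le> 4/3" using sum_quarter_powers_le[of 1 L] by simp
  finally show ?thesis .
qed

section \<open>Clipped chain increments and the chaining error\<close>

text \<open>
  Off the exceptional rows the clipping is inactive; it makes the increments bounded everywhere.
\<close>

definition clip :: "real \<Rightarrow> real \<Rightarrow> real" where
  "clip b t = max (- b) (min b t)"

text \<open>The width is the Lipschitz constant \<open>2 * (1/2) ^ i\<close> of the layer times
  \<open>(1/2) ^ (i + s)\<close>, which bounds the distance of consecutive approximations: their
  errors are at most a quarter and a half of it.\<close>

definition incr :: "nat \<Rightarrow> nat \<Rightarrow> complex \<Rightarrow> complex \<Rightarrow> real" where
  "incr i s u v = clip (2 * (1/4) ^ i * (1/2) ^ s) (layer i u - layer i v)"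

lemma abs_incr_le: "\<bar>incr i s u v\<bar> \<le> 2 * (1/4) ^ i * (1/2) ^ s"
proof -
  have "\<bar>clip b t\<bar> \<le> b" if "0 \<le> b" for b t using that unfolding clip_def by linarith
  then show ?thesis unfolding incr_def by simp
qed

lemma incr_eq_0: "cmod u \<le> (1/2) ^ Suc i \<Longrightarrow> cmod v \<le> (1/2) ^ Suc i \<Longrightarrow> incr i s u v = 0"
  unfolding incr_def clip_def by (auto simp: layer_eq_0)

text \<open>The chain of layer \<open>i\<close> starts at the zero function, followed by \<open>g i, g (i + 1), \<dots>\<close>.\<close>

definition level_pred :: "(nat \<Rightarrow> 'j \<Rightarrow> complex) \<Rightarrow> nat \<Rightarrow> nat \<Rightarrow> 'j \<Rightarrow> complex" where
  "level_pred g i s = (if s = 0 then (\<lambda>_. 0) else g (i + s - 1))"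

text \<open>If all approximations of row \<open>j\<close> are good, no increment is clipped, the sum
  telescopes to the layer of the last approximation, and the Lipschitz bound gives the first term;
  for \<open>cmod (y j) < (1/2) ^ i / 4\<close> both layers vanish. Otherwise some indicator in the
  second term is 1, and its factor 5 covers 4 for the increments and 1 for the layer itself.\<close>

lemma layer_chain_error:
  fixes g :: "nat \<Rightarrow> 'j \<Rightarrow> complex"
  shows "\<bar>layer i (y j) - (\<Sum>s\<le>S. incr i s (g (i + s) j) (level_pred g i s j))\<bar>
    \<le> 1/2 * (1/4) ^ i * (1/2) ^ S * of_bool ((1/2) ^ i / 4 \<le> cmod (y j))
      + 5 * (1/4) ^ i * (\<Sum>s\<le>S. of_bool ((1/2) ^ (i + s) / 4 < cmod (g (i + s) j - y j)))"
    (is "?err \<le> ?R + 5 * (1/4) ^ i * ?B")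
proof (cases "\<forall>s\<le>S. cmod (g (i + s) j - y j) \<le> (1/2) ^ (i + s) / 4")
  case True
  \<comment> \<open>Layer \<open>i\<close> of the predecessor in the chain, so the unclipped
    increments telescope from 0.\<close>
  define a where "a s = (if s = 0 then 0 else layer i (g (i + s - 1) j))" for s
  have l0: "layer i 0 = 0" by (rule layer_eq_0) simp
  have q: "(1/2 :: real) ^ i * (1/2) ^ i = (1/4) ^ i" by (simp flip: power_mult_distrib)
  have "incr i s (g (i + s) j) (level_pred g i s j) = a (Suc s) - a s" if s: "s \<le> S" for s
  proof -
    have eq: "layer i (g (i + s) j) - layer i (level_pred g i s j) = a (Suc s) - a s"
      by (auto simp: a_def level_pred_def l0)
    have "\<bar>a (Suc s) - a s\<bar> \<le> 2 * (1/4) ^ i * (1/2) ^ s"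
    proof (cases s)
      case 0
      then show ?thesis using layer_le[of i "g i j"] layer_nonneg[of i "g i j"]
        by (simp add: a_def)
    next
      case (Suc s')
      have d1: "cmod (g (i + s) j - y j) \<le> (1/2) ^ (i + s) / 4" using True s by simp
      have d2: "cmod (g (i + s') j - y j) \<le> (1/2) ^ (i + s') / 4" using True s Suc by simp
      have "cmod (g (i + s) j - g (i + s') j) \<le> cmod (g (i + s) j - y j) + cmod (g (i + s') j - y j)"
        using norm_triangle_ineq4[of "g (i + s) j - y j" "g (i + s') j - y j"] by simp
      also have "\<dots> \<le> (1/2) ^ i * (1/2) ^ s"
        using d1 d2 Suc zero_le_power[of "1/2 :: real" "i + s'"] by (simp add: power_add del: zero_le_power)
      finally have "2 * (1/2) ^ i * cmod (g (i + s) j - g (i + s') j) \<le> 2 * (1/2) ^ i * ((1/2) ^ i * (1/2) ^ s)"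
        by (rule mult_left_mono) simp
      then show ?thesis
        using layer_lipschitz[of i "g (i + s) j" "g (i + s') j"] Suc q
        by (simp add: a_def mult.assoc[symmetric])
    qed
    then show ?thesis unfolding incr_def clip_def eq by linarith
  qed
  then have "(\<Sum>s\<le>S. incr i s (g (i + s) j) (level_pred g i s j)) = (\<Sum>s<Suc S. a (Suc s) - a s)"
    by (simp add: lessThan_Suc_atMost)
  also have "\<dots> = layer i (g (i + S) j)" by (subst sum_lessThan_telescope) (simp add: a_def)
  finally have err: "?err = \<bar>layer i (y j) - layer i (g (i + S) j)\<bar>" by simp
  have dS: "cmod (g (i + S) j - y j) \<le> (1/2) ^ i * (1/2) ^ S / 4" using True by (simp add: power_add)
  have "?err \<le> ?R"
  proof (cases "(1/2) ^ i / 4 \<le> cmod (y j)")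
    case True
    have "?err \<le> 2 * (1/2) ^ i * cmod (g (i + S) j - y j)"
      unfolding err using layer_lipschitz[of i "y j" "g (i + S) j"] by (simp add: norm_minus_commute)
    also have "\<dots> \<le> 2 * (1/2) ^ i * ((1/2) ^ i * (1/2) ^ S / 4)"
      using dS by (rule mult_left_mono) simp
    also have "\<dots> = 1/2 * (1/4) ^ i * (1/2) ^ S" using q by simp
    finally show ?thesis using True by simp
  next
    case False
    have "(1/2 :: real) ^ i * (1/2) ^ S / 4 \<le> (1/2) ^ i / 4"
      by (simp add: mult_left_le power_le_one)
    moreover have "cmod (g (i + S) j) \<le> cmod (y j) + cmod (g (i + S) j - y j)"
      using norm_triangle_ineq[of "y j" "g (i + S) j - y j"] by simp
    moreover have "0 \<le> (1/2 :: real) ^ i" by simp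
    ultimately have "cmod (g (i + S) j) \<le> (1/2) ^ Suc i" "cmod (y j) \<le> (1/2) ^ Suc i"
      using dS False unfolding power_Suc by linarith+
    then show ?thesis unfolding err by (simp add: layer_eq_0)
  qed
  moreover have "0 \<le> 5 * (1/4 :: real) ^ i * ?B" by (intro mult_nonneg_nonneg sum_nonneg) auto
  ultimately show ?thesis by linarith
next
  case False
  then obtain s where s: "s \<le> S" "(1/2) ^ (i + s) / 4 < cmod (g (i + s) j - y j)" by force
  have "1 \<le> ?B" using member_le_sum[of s "{..S}" "\<lambda>s. of_bool ((1/2) ^ (i + s) / 4 < cmod (g (i + s) j - y j)) :: real"] s
    by simp
  then have B: "5 * (1/4) ^ i * 1 \<le> 5 * (1/4 :: real) ^ i * ?B" by (intro mult_left_mono) auto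
  have "\<bar>\<Sum>s\<le>S. incr i s (g (i + s) j) (level_pred g i s j)\<bar> \<le> (\<Sum>s\<le>S. 2 * (1/4) ^ i * (1/2) ^ s)"
    by (intro order_trans[OF sum_abs] sum_mono abs_incr_le)
  also have "\<dots> = 2 * (1/4) ^ i * (\<Sum>s<Suc S. (1/2) ^ s)"
    by (simp add: sum_distrib_left lessThan_Suc_atMost)
  also have "\<dots> \<le> 2 * (1/4) ^ i * 2"
    by (rule mult_left_mono) (subst sum_gp_strict, auto)
  finally have "?err \<le> 5 * (1/4) ^ i" using layer_le[of i "y j"] layer_nonneg[of i "y j"] by linarith
  moreover have "0 \<le> ?R" by simp
  ultimately show ?thesis using B by linarith
qed

text \<open>The layers in which a row takes part have total weight comparable to the energy of the
  row; this is what turns errors per layer into a relative error. Squaring the condition gives the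
  threshold \<open>T = 16 * (cmod z)\<^sup>2\<close>.\<close>

lemma sum_quarter_powers_cmod:
  "(\<Sum>i<L. (1/4 :: real) ^ i * of_bool ((1/2) ^ i / 4 \<le> cmod z)) \<le> 64 / 3 * (cmod z)\<^sup>2"
proof -
  have "((1/2) ^ i / 4 \<le> cmod z) = ((1/4) ^ i \<le> 16 * (cmod z)\<^sup>2)" for i
  proof -
    have "((1/2) ^ i / 4 \<le> cmod z) = (((1/2) ^ i / 4)\<^sup>2 \<le> (cmod z)\<^sup>2)"
      by (rule power_mono_iff[symmetric]) auto
    also have "((1/2) ^ i / 4)\<^sup>2 = ((1/4) ^ i / 16 :: real)"
      by (simp add: power2_eq_square flip: power_mult_distrib)
    finally show ?thesis by auto
  qed
  then have "(\<Sum>i<L. (1/4 :: real) ^ i * of_bool ((1/2) ^ i / 4 \<le> cmod z)) \<le> 4 / 3 * min (16 * (cmod z)\<^sup>2) 1"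
    using sum_quarter_powers_le[of "16 * (cmod z)\<^sup>2" L] by simp
  then show ?thesis by linarith
qed

text \<open>The errors are the part below the last layer, the exceptional rows, with
  \<open>20 / 3 = 5 * 4 / 3\<close>, and the ends of the chains, with
  \<open>32 / 3 = 1 / 2 * 64 / 3\<close>. The last is proportional to the energy since a row pays
  only in layers of height at most \<open>4 * cmod (y j)\<close>.\<close>

lemma chain_error:
  fixes g :: "nat \<Rightarrow> 'j \<Rightarrow> complex" and \<rho> :: "'j \<Rightarrow> real"
  assumes \<rho>: "\<And>j. j \<in> J \<Longrightarrow> 0 \<le> \<rho> j" "(\<Sum>j\<in>J. \<rho> j) = 1"
    and y: "\<And>j. j \<in> J \<Longrightarrow> cmod (y j) \<le> 1"
    and bad: "\<And>n. n < L + S \<Longrightarrow> (\<Sum>j\<in>J. \<rho> j * of_bool ((1/2) ^ n / 4 < cmod (g n j - y j))) \<le> \<gamma>" and \<gamma>: "0 \<le> \<gamma>"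
  shows "\<bar>(\<Sum>j\<in>J. \<rho> j * (cmod (y j))\<^sup>2)
      - (\<Sum>i<L. \<Sum>s\<le>S. \<Sum>j\<in>J. \<rho> j * incr i s (g (i + s) j) (level_pred g i s j))\<bar>
    \<le> (1/4) ^ L + 20 / 3 * ((real S + 1) * \<gamma>) + 32 / 3 * ((1/2) ^ S * (\<Sum>j\<in>J. \<rho> j * (cmod (y j))\<^sup>2))"
proof -
  let ?D = "\<lambda>i j. \<Sum>s\<le>S. incr i s (g (i + s) j) (level_pred g i s j)"
  let ?b = "\<lambda>n j. of_bool ((1/2) ^ n / 4 < cmod (g n j - y j)) :: real"
  let ?on = "\<lambda>i j. of_bool ((1/2) ^ i / 4 \<le> cmod (y j)) :: real"
  have pointwise: "\<bar>(cmod (y j))\<^sup>2 - (\<Sum>i<L. ?D i j)\<bar>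
      \<le> (1/4) ^ L + 32 / 3 * (1/2) ^ S * (cmod (y j))\<^sup>2 + (\<Sum>i<L. 5 * (1/4) ^ i * (\<Sum>s\<le>S. ?b (i + s) j))"
    if j: "j \<in> J" for j
  proof -
    have "\<bar>(\<Sum>i<L. layer i (y j)) - (\<Sum>i<L. ?D i j)\<bar>
        \<le> (\<Sum>i<L. 1/2 * (1/4) ^ i * (1/2) ^ S * ?on i j + 5 * (1/4) ^ i * (\<Sum>s\<le>S. ?b (i + s) j))"
      unfolding sum_subtractf[symmetric]
      by (intro order_trans[OF sum_abs] sum_mono layer_chain_error)
    also have "\<dots> = 1/2 * (1/2) ^ S * (\<Sum>i<L. (1/4) ^ i * ?on i j) + (\<Sum>i<L. 5 * (1/4) ^ i * (\<Sum>s\<le>S. ?b (i + s) j))"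
      by (simp add: sum.distrib sum_distrib_left mult_ac)
    also have "1/2 * (1/2) ^ S * (\<Sum>i<L. (1/4) ^ i * ?on i j) \<le> 1/2 * (1/2) ^ S * (64 / 3 * (cmod (y j))\<^sup>2)"
      by (intro mult_left_mono sum_quarter_powers_cmod) auto
    also have "1/2 * (1/2) ^ S * (64 / 3 * (cmod (y j))\<^sup>2) = 32 / 3 * (1/2) ^ S * (cmod (y j))\<^sup>2"
      by simp
    finally show ?thesis using sum_layer[OF y[OF j], of L] by linarith
  qed
  have swap: "(\<Sum>j\<in>J. \<rho> j * (\<Sum>i<L. c i * (\<Sum>s\<le>S. f i s j)))
      = (\<Sum>i<L. c i * (\<Sum>s\<le>S. \<Sum>j\<in>J. \<rho> j * f i s j))" for c and f :: "nat \<Rightarrow> nat \<Rightarrow> 'j \<Rightarrow> real"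
  proof -
    have "(\<Sum>j\<in>J. \<rho> j * (\<Sum>i<L. c i * (\<Sum>s\<le>S. f i s j)))
        = (\<Sum>j\<in>J. \<Sum>i<L. \<Sum>s\<le>S. c i * (\<rho> j * f i s j))"
      by (simp add: sum_distrib_left mult_ac)
    also have "\<dots> = (\<Sum>i<L. \<Sum>j\<in>J. \<Sum>s\<le>S. c i * (\<rho> j * f i s j))" by (rule sum.swap)
    also have "\<dots> = (\<Sum>i<L. \<Sum>s\<le>S. \<Sum>j\<in>J. c i * (\<rho> j * f i s j))"
      by (intro sum.cong refl) (rule sum.swap)
    finally show ?thesis by (simp add: sum_distrib_left)
  qed
  have eq: "(\<Sum>j\<in>J. \<rho> j * (cmod (y j))\<^sup>2) - (\<Sum>i<L. \<Sum>s\<le>S. \<Sum>j\<in>J. \<rho> j * incr i s (g (i + s) j) (level_pred g i s j))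
      = (\<Sum>j\<in>J. \<rho> j * ((cmod (y j))\<^sup>2 - (\<Sum>i<L. ?D i j)))"
    using swap[of "\<lambda>_. 1" "\<lambda>i s j. incr i s (g (i + s) j) (level_pred g i s j)"]
    by (simp add: right_diff_distrib sum_subtractf)
  have bound: "\<bar>\<Sum>j\<in>J. \<rho> j * ((cmod (y j))\<^sup>2 - (\<Sum>i<L. ?D i j))\<bar> \<le> (\<Sum>j\<in>J. \<rho> j * ((1/4) ^ L + 32 / 3 * (1/2) ^ S * (cmod (y j))\<^sup>2
      + (\<Sum>i<L. 5 * (1/4) ^ i * (\<Sum>s\<le>S. ?b (i + s) j))))"
  proof (intro order_trans[OF sum_abs] sum_mono)
    fix j assume j: "j \<in> J"
    show "\<bar>\<rho> j * ((cmod (y j))\<^sup>2 - (\<Sum>i<L. ?D i j))\<bar> \<le> \<rho> j * ((1/4) ^ L + 32 / 3 * (1/2) ^ S * (cmod (y j))\<^sup>2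
      + (\<Sum>i<L. 5 * (1/4) ^ i * (\<Sum>s\<le>S. ?b (i + s) j)))"
      unfolding abs_mult using pointwise[OF j] \<rho>(1)[OF j] by (simp only: abs_of_nonneg mult_left_mono)
  qed
  have split: "(\<Sum>j\<in>J. \<rho> j * ((1/4) ^ L + 32 / 3 * (1/2) ^ S * (cmod (y j))\<^sup>2
      + (\<Sum>i<L. 5 * (1/4) ^ i * (\<Sum>s\<le>S. ?b (i + s) j))))
    = (1/4) ^ L * (\<Sum>j\<in>J. \<rho> j) + 32 / 3 * ((1/2) ^ S * (\<Sum>j\<in>J. \<rho> j * (cmod (y j))\<^sup>2))
      + (\<Sum>i<L. 5 * (1/4) ^ i * (\<Sum>s\<le>S. \<Sum>j\<in>J. \<rho> j * ?b (i + s) j))"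
    unfolding distrib_left sum.distrib swap by (simp add: sum_distrib_left sum_distrib_right mult_ac)
  have "(\<Sum>i<L. 5 * (1/4) ^ i * (\<Sum>s\<le>S. \<Sum>j\<in>J. \<rho> j * ?b (i + s) j))
      \<le> (\<Sum>i<L. 5 * (1/4) ^ i * (\<Sum>s\<le>S. \<gamma>))"
    by (intro sum_mono mult_left_mono bad) auto
  also have "\<dots> = 5 * ((real S + 1) * \<gamma>) * (\<Sum>i<L. (1/4) ^ i)"
    unfolding sum_distrib_left by (intro sum.cong refl) (simp add: algebra_simps)
  also have "\<dots> \<le> 5 * ((real S + 1) * \<gamma>) * (4/3)"
    using \<gamma> by (intro mult_left_mono sum_quarter_powers) auto
  finally show ?thesis using bound unfolding eq split \<rho>(2) by linarith
qed

text \<open>The deterministic core, to be applied with \<open>\<mu>\<close> uniform on all rows and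
  \<open>\<nu>\<close> the law of the sample. Each energy is replaced by its chain sum through
  \<open>chain_error\<close>, and the chain sums are compared increment by increment through
  \<open>close\<close>. The divisors \<open>real L\<close> and \<open>real S + 1\<close> make the
  additive allowances sum to a single \<open>\<eta>\<close>, and the relative ones are summed by
  \<open>sum_quarter_powers_cmod\<close>.\<close>

lemma empirical_energy_close:
  fixes g :: "nat \<Rightarrow> 'j \<Rightarrow> complex" and \<mu> \<nu> :: "'j \<Rightarrow> real"
  assumes \<mu>: "\<And>j. j \<in> J \<Longrightarrow> 0 \<le> \<mu> j" "(\<Sum>j\<in>J. \<mu> j) = 1"
    and \<nu>: "\<And>j. j \<in> J \<Longrightarrow> 0 \<le> \<nu> j" "(\<Sum>j\<in>J. \<nu> j) = 1"
    and y: "\<And>j. j \<in> J \<Longrightarrow> cmod (y j) \<le> 1"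
    and \<mu>bad: "\<And>n. n < L + S \<Longrightarrow> (\<Sum>j\<in>J. \<mu> j * of_bool ((1/2) ^ n / 4 < cmod (g n j - y j))) \<le> \<gamma>"
    and \<nu>bad: "\<And>n. n < L + S \<Longrightarrow> (\<Sum>j\<in>J. \<nu> j * of_bool ((1/2) ^ n / 4 < cmod (g n j - y j))) \<le> \<gamma>"
    and close: "\<And>i s. i < L \<Longrightarrow> s \<le> S \<Longrightarrow>
      \<bar>(\<Sum>j\<in>J. \<nu> j * incr i s (g (i + s) j) (level_pred g i s j))
        - (\<Sum>j\<in>J. \<mu> j * incr i s (g (i + s) j) (level_pred g i s j))\<bar>
      \<le> (\<delta> * (1/4) ^ i * (\<Sum>j\<in>J. \<mu> j * of_bool ((1/2) ^ Suc i < cmod (g (i + s) j)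
            \<or> (1/2) ^ Suc i < cmod (level_pred g i s j))) + \<eta> / real L) / (real S + 1)"
    and par: "0 < L" "0 \<le> \<gamma>" "0 \<le> \<delta>" "22 * \<delta> \<le> 1" "(1/2) ^ S \<le> \<delta>" "(1/4) ^ L \<le> \<eta>"
      "16 * (real S + 1) * \<gamma> \<le> \<eta>"
  shows "\<bar>(\<Sum>j\<in>J. \<nu> j * (cmod (y j))\<^sup>2) - (\<Sum>j\<in>J. \<mu> j * (cmod (y j))\<^sup>2)\<bar>
    \<le> 10 * \<eta> + 88 * \<delta> * (\<Sum>j\<in>J. \<mu> j * (cmod (y j))\<^sup>2)"
proof -
  let ?D = "\<lambda>\<rho> i s. \<Sum>j\<in>J. \<rho> j * incr i s (g (i + s) j) (level_pred g i s j)"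
  let ?on = "\<lambda>i j. of_bool ((1/2) ^ i / 4 \<le> cmod (y j)) :: real"
  let ?b = "\<lambda>n j. of_bool ((1/2) ^ n / 4 < cmod (g n j - y j)) :: real"
  let ?p = "\<lambda>i s j. of_bool ((1/2) ^ Suc i < cmod (g (i + s) j)
            \<or> (1/2) ^ Suc i < cmod (level_pred g i s j)) :: real"
  define e where "e \<rho> = (\<Sum>j\<in>J. \<rho> j * (cmod (y j))\<^sup>2)" for \<rho> :: "'j \<Rightarrow> real"
  define \<pi> where "\<pi> i = (\<Sum>j\<in>J. \<mu> j * ?on i j)" for i
  have prob: "(\<Sum>j\<in>J. \<mu> j * ?p i s j) \<le> \<pi> i + 2 * \<gamma>" if lv: "i < L" "s \<le> S" for i s
  proof -
    \<comment> \<open>Otherwise \<open>cmod (g n j)\<close> would be less than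
      \<open>(1/2) ^ i / 4 + (1/2) ^ n / 4\<close>, which is at most
      \<open>(1/2) ^ Suc i\<close>.\<close>
    have near: "?on i j = 1 \<or> ?b n j = 1" if "(1/2) ^ Suc i < cmod (g n j)" "i \<le> n" for n j
    proof (rule ccontr)
      assume "\<not> ?thesis"
      then have "cmod (y j) < (1/2) ^ i / 4" "cmod (g n j - y j) \<le> (1/2) ^ n / 4" by auto
      moreover have "(1/2 :: real) ^ n \<le> (1/2) ^ i" using that(2) by (intro power_decreasing) auto
      moreover have "cmod (g n j) \<le> cmod (y j) + cmod (g n j - y j)"
        using norm_triangle_ineq[of "y j" "g n j - y j"] by simp
      ultimately show False using that(1) unfolding power_Suc by linarith
    qed
    \<comment> \<open>For \<open>s = 0\<close> the predecessor is zero and never exceeds the level;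
      the term at \<open>i + s - 1\<close> is then only a nonnegative surplus.\<close>
    have "?p i s j \<le> ?on i j + ?b (i + s) j + ?b (i + s - 1) j" for j
      using near[where n = "i + s" and j = j] near[where n = "i + s - 1" and j = j]
      by (cases s) (auto simp: level_pred_def)
    then have "(\<Sum>j\<in>J. \<mu> j * ?p i s j) \<le> (\<Sum>j\<in>J. \<mu> j * (?on i j + ?b (i + s) j + ?b (i + s - 1) j))"
      using \<mu> by (intro sum_mono mult_left_mono) auto
    also have "\<dots> = \<pi> i + (\<Sum>j\<in>J. \<mu> j * ?b (i + s) j) + (\<Sum>j\<in>J. \<mu> j * ?b (i + s - 1) j)"
      by (simp add: \<pi>_def distrib_left sum.distrib)
    also have "\<dots> \<le> \<pi> i + \<gamma> + \<gamma>" using lv by (intro add_mono \<mu>bad) auto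
    finally show ?thesis by simp
  qed
  have "\<bar>(\<Sum>i<L. \<Sum>s\<le>S. ?D \<nu> i s) - (\<Sum>i<L. \<Sum>s\<le>S. ?D \<mu> i s)\<bar> = \<bar>\<Sum>i<L. \<Sum>s\<le>S. ?D \<nu> i s - ?D \<mu> i s\<bar>"
    by (simp add: sum_subtractf)
  also have "\<dots> \<le> (\<Sum>i<L. \<Sum>s\<le>S. (\<delta> * (1/4) ^ i * (\<pi> i + 2 * \<gamma>) + \<eta> / real L) / (real S + 1))"
  proof (intro order_trans[OF sum_abs] sum_mono)
    fix i s assume "i \<in> {..<L}" "s \<in> {..S}"
    then have lv: "i < L" "s \<le> S" by auto
    show "\<bar>?D \<nu> i s - ?D \<mu> i s\<bar> \<le> (\<delta> * (1/4) ^ i * (\<pi> i + 2 * \<gamma>) + \<eta> / real L) / (real S + 1)"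
      using par by (intro order_trans[OF close[OF lv]] divide_right_mono add_right_mono mult_left_mono prob[OF lv]) auto
  qed
  also have "\<dots> = (\<Sum>i<L. \<delta> * (1/4) ^ i * (\<pi> i + 2 * \<gamma>) + \<eta> / real L)"
  proof -
    have "(\<Sum>s\<le>S. x / (real S + 1)) = x" for x :: real by (simp add: field_simps)
    then show ?thesis by simp
  qed
  also have "\<dots> = \<delta> * (\<Sum>i<L. (1/4) ^ i * \<pi> i) + 2 * \<gamma> * \<delta> * (\<Sum>i<L. (1/4) ^ i) + \<eta>"
    using par(1) by (simp add: sum.distrib sum_distrib_left algebra_simps)
  finally have middle: "\<bar>(\<Sum>i<L. \<Sum>s\<le>S. ?D \<nu> i s) - (\<Sum>i<L. \<Sum>s\<le>S. ?D \<mu> i s)\<bar>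
      \<le> \<delta> * (\<Sum>i<L. (1/4) ^ i * \<pi> i) + 2 * \<gamma> * \<delta> * (\<Sum>i<L. (1/4) ^ i) + \<eta>" .
  have "(\<Sum>i<L. (1/4) ^ i * \<pi> i) = (\<Sum>j\<in>J. \<mu> j * (\<Sum>i<L. (1/4) ^ i * ?on i j))"
    unfolding \<pi>_def sum_distrib_left by (subst sum.swap) (simp add: mult_ac)
  also have "\<dots> \<le> (\<Sum>j\<in>J. \<mu> j * (64 / 3 * (cmod (y j))\<^sup>2))"
    using \<mu> by (intro sum_mono mult_left_mono sum_quarter_powers_cmod)
  also have "\<dots> = 64 / 3 * e \<mu>" by (simp add: e_def sum_distrib_left mult_ac)
  finally have "\<delta> * (\<Sum>i<L. (1/4) ^ i * \<pi> i) \<le> \<delta> * (64 / 3 * e \<mu>)"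
    using par(3) by (rule mult_left_mono)
  moreover have "2 * \<gamma> * \<delta> * (\<Sum>i<L. (1/4) ^ i) \<le> 2 * \<gamma> * \<delta> * (4/3)"
    using par by (intro mult_left_mono sum_quarter_powers) auto
  ultimately have middle: "\<bar>(\<Sum>i<L. \<Sum>s\<le>S. ?D \<nu> i s) - (\<Sum>i<L. \<Sum>s\<le>S. ?D \<mu> i s)\<bar>
      \<le> \<delta> * (64 / 3 * e \<mu>) + 2 * \<gamma> * \<delta> * (4/3) + \<eta>"
    using middle by linarith
  have e0: "0 \<le> e \<mu>" "0 \<le> e \<nu>" using \<mu> \<nu> by (auto simp: e_def intro!: sum_nonneg)
  have outer: "\<bar>e \<rho> - (\<Sum>i<L. \<Sum>s\<le>S. ?D \<rho> i s)\<bar> \<le> \<eta> + 5 / 12 * \<eta> + 32 / 3 * (\<delta> * e \<rho>)"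
    if "\<rho> = \<mu> \<or> \<rho> = \<nu>" for \<rho>
  proof -
    have "\<bar>e \<rho> - (\<Sum>i<L. \<Sum>s\<le>S. ?D \<rho> i s)\<bar>
        \<le> (1/4) ^ L + 20 / 3 * ((real S + 1) * \<gamma>) + 32 / 3 * ((1/2) ^ S * e \<rho>)"
      unfolding e_def
      by (rule chain_error) (use that \<mu> \<nu> y \<mu>bad \<nu>bad par in auto)
    also have "\<dots> \<le> \<eta> + 5 / 12 * \<eta> + 32 / 3 * (\<delta> * e \<rho>)"
    proof -
      have "(real S + 1) * \<gamma> \<le> \<eta> / 16" using par(7) by (simp add: algebra_simps)
      moreover have "(1/2) ^ S * e \<rho> \<le> \<delta> * e \<rho>" using par(5) e0 that by (intro mult_right_mono) auto
      ultimately show ?thesis using par(6) by linarith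
    qed
    finally show ?thesis .
  qed
  have "(16 * \<gamma>) * \<delta> \<le> (16 * \<gamma>) * (real S + 1)"
    using par by (intro mult_left_mono) auto
  then have "\<gamma> * \<delta> \<le> \<eta> / 16" using par(7) by (simp add: mult_ac)
  moreover have "\<bar>e \<nu> - e \<mu>\<bar> \<le> (\<eta> + 5 / 12 * \<eta> + 32 / 3 * (\<delta> * e \<mu>)) + (\<eta> + 5 / 12 * \<eta> + 32 / 3 * (\<delta> * e \<nu>))
     + (\<delta> * (64 / 3 * e \<mu>) + 2 * \<gamma> * \<delta> * (4/3) + \<eta>)"
    using middle outer[OF disjI1[OF refl]] outer[OF disjI2[OF refl]] by linarith
  \<comment> \<open>The bound involves the energy under \<open>\<nu>\<close> itself, which is absorbed because \<open>\<delta>\<close> is small.\<close>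
  moreover have "\<delta> * e \<nu> \<le> \<delta> * e \<mu> + 1 / 22 * \<bar>e \<nu> - e \<mu>\<bar>"
  proof -
    have "\<delta> * e \<nu> \<le> \<delta> * (e \<mu> + \<bar>e \<nu> - e \<mu>\<bar>)" using par by (intro mult_left_mono) auto
    also have "\<dots> \<le> \<delta> * e \<mu> + 1 / 22 * \<bar>e \<nu> - e \<mu>\<bar>"
      using par mult_right_mono[of \<delta> "1/22" "\<bar>e \<nu> - e \<mu>\<bar>"] by (simp add: distrib_left)
    finally show ?thesis .
  qed
  moreover have "0 \<le> \<eta>" using par(6) by (meson order_trans zero_le_power zero_le_divide_1_iff zero_le_numeral)
  moreover have "0 \<le> \<delta> * e \<mu>" using par e0 by simp
  \<comment> \<open>Substituting for \<open>b\<close> leaves the coefficient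
    \<open>32 / 3 / 22 = 16 / 33\<close> on \<open>D\<close> at the right. As it is below 1 it moves
    to the left, and 10 and 88 round up what results.\<close>
  moreover have "D \<le> 10 * \<eta> + 88 * a"
    if "c \<le> \<eta> / 16"
      "D \<le> (\<eta> + 5 / 12 * \<eta> + 32 / 3 * a) + (\<eta> + 5 / 12 * \<eta> + 32 / 3 * b) + (64 / 3 * a + 8 / 3 * c + \<eta>)"
      "b \<le> a + 1 / 22 * D" "0 \<le> \<eta>" "0 \<le> a" for D a b c :: real
    using that by linarith
  ultimately have "\<bar>e \<nu> - e \<mu>\<bar> \<le> 10 * \<eta> + 88 * (\<delta> * e \<mu>)" by (simp add: mult_ac)
  then show ?thesis by (simp add: e_def mult.assoc)
qed

section \<open>Random sampling of rows\<close>

text \<open>Written as weights on the rows, the sample has the same form as the uniform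
  distribution, so the chaining lemmas apply to both.\<close>

definition empirical :: "nat \<Rightarrow> (nat \<Rightarrow> 'j) \<Rightarrow> 'j \<Rightarrow> real" where
  "empirical q r j = real (card {t. t < q \<and> r t = j}) / real q"

lemma sum_empirical:
  assumes "finite J" "\<And>t. t < q \<Longrightarrow> r t \<in> J"
  shows "(\<Sum>j\<in>J. empirical q r j * h j) = (\<Sum>t<q. h (r t)) / real q"
proof -
  have "(\<Sum>t<q. h (r t)) = (\<Sum>j\<in>J. \<Sum>t | t \<in> {..<q} \<and> r t = j. h (r t))"
    using assms by (intro sum.group[symmetric]) auto
  also have "\<dots> = (\<Sum>j\<in>J. real (card {t. t < q \<and> r t = j}) * h j)"
    by (intro sum.cong) auto
  finally show ?thesis by (simp add: empirical_def sum_divide_distrib)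
qed

text \<open>Bernstein, with the second moment proportional to the fraction \<open>\<pi>\<close> of
  rows where the increment can be nonzero. The variance condition becomes
  \<open>a * b \<le> (a + b)\<^sup>2\<close> for the relative part \<open>a\<close> and the absolute
  part \<open>b = \<eta>\<close> of the threshold; the linear one follows from
  \<open>\<delta> * 2 ^ s \<le> 2\<close>. The factor \<open>4 ^ (i + s)\<close> in the exponent
  matches the logarithm of the number of averages used at level \<open>i + s\<close>.\<close>

lemma incr_deviation:
  fixes u v :: "nat \<Rightarrow> complex" and N i :: nat
  defines "\<pi> \<equiv> (\<Sum>j<N. of_bool ((1/2) ^ Suc i < cmod (u j) \<or> (1/2) ^ Suc i < cmod (v j))) / real N"
  assumes N: "0 < N" and q: "0 < q" and \<delta>: "0 < \<delta>" and \<eta>: "0 < \<eta>"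
    and s: "s \<le> S" and S: "\<delta> * 2 ^ S \<le> 2"
  shows "measure_pmf.prob (Pi_pmf {..<q} d (\<lambda>_. pmf_of_set {..<N}))
      {r. (\<delta> * (1/4) ^ i * \<pi> + \<eta>) / (real S + 1)
          \<le> \<bar>(\<Sum>t<q. incr i s (u (r t)) (v (r t))) / real q - (\<Sum>j<N. incr i s (u j) (v j)) / real N\<bar>}
    \<le> 2 * exp (- real q * (4 ^ (i + s) * (\<delta> * \<eta> / (16 * (real S + 1)\<^sup>2))))"
proof -
  let ?p = "pmf_of_set {..<N}"
  let ?X = "\<lambda>j. incr i s (u j) (v j)"
  let ?b = "2 * (1/4) ^ i * (1/2) ^ s :: real"
  let ?lam = "(\<delta> * (1/4) ^ i * \<pi> + \<eta>) / (real S + 1)"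
  let ?kap = "4 ^ (i + s) * (\<delta> * \<eta> / (16 * (real S + 1)\<^sup>2))"
  have ne: "finite {..<N}" "{..<N} \<noteq> {}" using N by auto
  have ex: "measure_pmf.expectation ?p h = (\<Sum>j<N. h j) / real N" for h :: "nat \<Rightarrow> real"
    using integral_pmf_of_set[OF ne(2,1), of h] by simp
  have \<pi>0: "0 \<le> \<pi>" by (auto simp: \<pi>_def intro!: sum_nonneg divide_nonneg_nonneg)
  have four: "(4 :: real) ^ s = 2 ^ s * 2 ^ s" by (simp flip: power_mult_distrib)
  have bn: "(?b)\<^sup>2 * 4 ^ (i + s) = 4 * (1/4) ^ i"
    using four by (simp add: power_one_over power2_eq_square power_add field_simps)
  have bl: "?b * 4 ^ (i + s) = 2 * 2 ^ s"
    using four by (simp add: power_one_over power_add field_simps)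
  have "measure_pmf.prob (Pi_pmf {..<q} d (\<lambda>_. ?p))
     {r. ?lam \<le> \<bar>(\<Sum>t<q. ?X (r t)) / real q - measure_pmf.expectation ?p ?X\<bar>} \<le> 2 * exp (- real q * ?kap)"
  proof (rule bernstein_Pi_pmf[where b = ?b and v = "(?b)\<^sup>2 * \<pi>"])
    show "finite (set_pmf ?p)" using ne by simp
    show "\<bar>?X x\<bar> \<le> ?b" for x by (rule abs_incr_le)
    have "(?X j)\<^sup>2 \<le> (?b)\<^sup>2 * of_bool ((1/2) ^ Suc i < cmod (u j) \<or> (1/2) ^ Suc i < cmod (v j))" for j
    proof (cases "(1/2) ^ Suc i < cmod (u j) \<or> (1/2) ^ Suc i < cmod (v j)")
      case True
      then show ?thesis using power_mono[OF abs_incr_le[of i s "u j" "v j"], of 2] by simp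
    next
      case False
      then show ?thesis by (simp add: incr_eq_0)
    qed
    then have "(\<Sum>j<N. (?X j)\<^sup>2) \<le> (\<Sum>j<N. (?b)\<^sup>2 * of_bool ((1/2) ^ Suc i < cmod (u j) \<or> (1/2) ^ Suc i < cmod (v j)))"
      by (rule sum_mono)
    then show "measure_pmf.expectation ?p (\<lambda>x. (?X x)\<^sup>2) \<le> (?b)\<^sup>2 * \<pi>"
      using N unfolding ex \<pi>_def sum_distrib_left[symmetric] by (simp add: divide_right_mono)
    show lam0: "0 < ?lam" using \<delta> \<eta> \<pi>0 by (intro divide_pos_pos add_nonneg_pos) auto
    show "0 \<le> ?kap" using \<delta> \<eta> by simp
    have "4 * ((?b)\<^sup>2 * \<pi>) * ?kap = ((?b)\<^sup>2 * 4 ^ (i + s)) * (4 * \<pi> * (\<delta> * \<eta> / (16 * (real S + 1)\<^sup>2)))"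
      by (simp only: mult_ac)
    also have "\<dots> = (\<delta> * (1/4) ^ i * \<pi>) * \<eta> / (real S + 1)\<^sup>2" unfolding bn by (simp add: field_simps)
    also have "\<dots> \<le> (\<delta> * (1/4) ^ i * \<pi> + \<eta>)\<^sup>2 / (real S + 1)\<^sup>2"
    proof (rule divide_right_mono)
      have "a * b \<le> (a + b)\<^sup>2" if "0 \<le> a" "0 \<le> b" for a b :: real
        using that by (simp add: power2_eq_square algebra_simps)
      then show "\<delta> * (1/4) ^ i * \<pi> * \<eta> \<le> (\<delta> * (1/4) ^ i * \<pi> + \<eta>)\<^sup>2" using \<delta> \<eta> \<pi>0 by simp
    qed simp
    finally show "4 * ((?b)\<^sup>2 * \<pi>) * ?kap \<le> ?lam\<^sup>2" by (simp add: power_divide)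
    have "2 * ?b * ?kap = 2 * (?b * 4 ^ (i + s)) * (\<delta> * \<eta> / (16 * (real S + 1)\<^sup>2))"
      by (simp only: mult_ac)
    also have "\<dots> = (\<delta> * 2 ^ s) * (\<eta> / (4 * (real S + 1)\<^sup>2))" unfolding bl by (simp add: field_simps)
    also have "\<dots> \<le> 2 * (\<eta> / (4 * (real S + 1)\<^sup>2))"
    proof (rule mult_right_mono)
      have "\<delta> * 2 ^ s \<le> \<delta> * 2 ^ S" using \<delta> s by (intro mult_left_mono power_increasing) auto
      then show "\<delta> * 2 ^ s \<le> 2" using S by simp
    qed (use \<eta> in simp)
    also have "\<dots> = \<eta> / (real S + 1) * (1 / (2 * (real S + 1)))" by (simp add: power2_eq_square)
    also have "\<dots> \<le> \<eta> / (real S + 1)" using \<eta> by (intro mult_left_le) auto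
    also have "\<dots> \<le> ?lam" using \<delta> \<pi>0 by (intro divide_right_mono) auto
    finally show "2 * ?b * ?kap \<le> ?lam" .
    show "0 < q" by fact
  qed
  then show ?thesis unfolding ex .
qed

text \<open>All pairs of candidates are controlled at once, so the approximations may be picked
  after the sample is known. The family at \<open>s = 0\<close> mirrors
  \<open>level_pred\<close>.\<close>

definition good_sample ::
  "nat \<Rightarrow> nat \<Rightarrow> real \<Rightarrow> real \<Rightarrow> nat \<Rightarrow> nat \<Rightarrow> (nat \<Rightarrow> (nat \<Rightarrow> complex) set) \<Rightarrow> (nat \<Rightarrow> nat) \<Rightarrow> bool" where
  "good_sample L S \<delta> \<eta> N q G r \<longleftrightarrow>
     (\<forall>i<L. \<forall>s\<le>S. \<forall>u\<in>G (i + s). \<forall>v\<in>(if s = 0 then {\<lambda>_. 0} else G (i + s - 1)).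
        \<bar>(\<Sum>t<q. incr i s (u (r t)) (v (r t))) / real q - (\<Sum>j<N. incr i s (u j) (v j)) / real N\<bar>
        < (\<delta> * (1/4) ^ i * ((\<Sum>j<N. of_bool ((1/2) ^ Suc i < cmod (u j) \<or> (1/2) ^ Suc i < cmod (v j))) / real N)
            + \<eta>) / (real S + 1))"

text \<open>At level \<open>n = i + s\<close> there are at most \<open>exp (2 * B * 4 ^ n)\<close>
  pairs, each failing with probability at most \<open>2 * exp (- (2 * B + X) * 4 ^ n)\<close>. What
  remains is at most \<open>2 * exp (- X)\<close> for each of the \<open>L * (S + 1)\<close> choices
  of \<open>i\<close> and \<open>s\<close>.\<close>

lemma prob_good_sample:
  assumes N: "0 < N" and q: "0 < q" and \<delta>: "0 < \<delta>" and \<eta>: "0 < \<eta>" and S: "\<delta> * 2 ^ S \<le> 2"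
    and G: "\<And>n. finite (G n)" "\<And>n. real (card (G n)) \<le> exp (B * 4 ^ n)" and B: "0 \<le> B"
    and qB: "2 * B + X \<le> real q * (\<delta> * \<eta> / (16 * (real S + 1)\<^sup>2))" and X: "0 \<le> X"
  shows "1 - 2 * real L * (real S + 1) * exp (- X)
    \<le> measure_pmf.prob (Pi_pmf {..<q} d (\<lambda>_. pmf_of_set {..<N})) {r. good_sample L S \<delta> \<eta> N q G r}"
proof -
  let ?P = "Pi_pmf {..<q} d (\<lambda>_. pmf_of_set {..<N})"
  let ?H = "\<lambda>i s. if s = 0 then {\<lambda>_. 0} else G (i + s - 1)"
  let ?bad = "\<lambda>i s u v. {r. (\<delta> * (1/4) ^ i * ((\<Sum>j<N. of_bool ((1/2) ^ Suc i < cmod (u j) \<or> (1/2) ^ Suc i < cmod (v j))) / real N)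
            + \<eta>) / (real S + 1)
        \<le> \<bar>(\<Sum>t<q. incr i s (u (r t)) (v (r t))) / real q - (\<Sum>j<N. incr i s (u j) (v j)) / real N\<bar>}"
  have pair: "measure_pmf.prob ?P (\<Union>(u, v) \<in> G (i + s) \<times> ?H i s. ?bad i s u v) \<le> 2 * exp (- X)"
    if s: "s \<le> S" for i s
  proof -
    let ?n = "i + s"
    have finH: "finite (?H i s)" using G by simp
    have "real (card (?H i s)) \<le> exp (B * 4 ^ ?n)"
    proof (cases "s = 0")
      case True then show ?thesis using B by simp
    next
      case False
      have "real (card (G (?n - 1))) \<le> exp (B * 4 ^ (?n - 1))" by (rule G)
      also have "\<dots> \<le> exp (B * 4 ^ ?n)"
        using B by (simp add: mult_left_mono power_increasing)
      finally show ?thesis using False by simp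
    qed
    then have card: "real (card (G ?n \<times> ?H i s)) \<le> exp (B * 4 ^ ?n) * exp (B * 4 ^ ?n)"
      unfolding card_cartesian_product of_nat_mult using G by (intro mult_mono) auto
    have "measure_pmf.prob ?P (\<Union>(u, v) \<in> G ?n \<times> ?H i s. ?bad i s u v)
        \<le> (\<Sum>(u, v) \<in> G ?n \<times> ?H i s. measure_pmf.prob ?P (?bad i s u v))"
      using measure_pmf.finite_measure_subadditive_finite[of "G ?n \<times> ?H i s" "\<lambda>(u, v). ?bad i s u v" ?P] G(1) finH
      by (simp add: case_prod_unfold)
    also have "\<dots> \<le> (\<Sum>(u, v) \<in> G ?n \<times> ?H i s. 2 * exp (- real q * (4 ^ ?n * (\<delta> * \<eta> / (16 * (real S + 1)\<^sup>2)))))"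
      using incr_deviation[OF N q \<delta> \<eta> s S] by (intro sum_mono) (auto simp only: case_prod_unfold)
    also have "\<dots> = real (card (G ?n \<times> ?H i s)) * (2 * exp (- (4 ^ ?n * (real q * (\<delta> * \<eta> / (16 * (real S + 1)\<^sup>2))))))"
      by (simp add: case_prod_unfold mult_ac)
    also have "\<dots> \<le> (exp (B * 4 ^ ?n) * exp (B * 4 ^ ?n)) * (2 * exp (- (4 ^ ?n * (2 * B + X))))"
    proof (intro mult_mono)
      show "exp (- (4 ^ ?n * (real q * (\<delta> * \<eta> / (16 * (real S + 1)\<^sup>2))))) \<le> exp (- (4 ^ ?n * (2 * B + X)))"
        unfolding exp_le_cancel_iff neg_le_iff_le using qB by (rule mult_left_mono) simp
    qed (use card in auto)
    also have "\<dots> = 2 * exp (- (4 ^ ?n * X))" by (simp add: algebra_simps flip: exp_add)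
    also have "\<dots> \<le> 2 * exp (- X)"
      using X mult_right_mono[of 1 "4 ^ ?n" X] by simp
    finally show ?thesis .
  qed
  have "{r. \<not> good_sample L S \<delta> \<eta> N q G r}
      \<subseteq> (\<Union>(i, s) \<in> {..<L} \<times> {..S}. \<Union>(u, v) \<in> G (i + s) \<times> ?H i s. ?bad i s u v)"
    unfolding good_sample_def by (auto simp only: not_less) fastforce
  then have "measure_pmf.prob ?P {r. \<not> good_sample L S \<delta> \<eta> N q G r}
      \<le> measure_pmf.prob ?P (\<Union>(i, s) \<in> {..<L} \<times> {..S}. \<Union>(u, v) \<in> G (i + s) \<times> ?H i s. ?bad i s u v)"
    by (intro measure_pmf.finite_measure_mono) auto
  also have "\<dots> \<le> (\<Sum>(i, s) \<in> {..<L} \<times> {..S}. measure_pmf.prob ?P (\<Union>(u, v) \<in> G (i + s) \<times> ?H i s. ?bad i s u v))"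
    using measure_pmf.finite_measure_subadditive_finite[of "{..<L} \<times> {..S}"
        "\<lambda>(i, s). \<Union>(u, v) \<in> G (i + s) \<times> ?H i s. ?bad i s u v" ?P]
    by (simp add: case_prod_unfold)
  also have "\<dots> \<le> (\<Sum>(i, s) \<in> {..<L} \<times> {..S}. 2 * exp (- X))"
    using pair by (intro sum_mono) auto
  also have "\<dots> = 2 * real L * (real S + 1) * exp (- X)" by (simp add: case_prod_unfold algebra_simps)
  finally have "measure_pmf.prob ?P {r. \<not> good_sample L S \<delta> \<eta> N q G r} \<le> 2 * real L * (real S + 1) * exp (- X)" .
  moreover have "measure_pmf.prob ?P {r. \<not> good_sample L S \<delta> \<eta> N q G r}
      = 1 - measure_pmf.prob ?P {r. good_sample L S \<delta> \<eta> N q G r}"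
    using measure_pmf.prob_compl[of "{r. good_sample L S \<delta> \<eta> N q G r}" ?P]
    by (simp add: Compl_eq_Diff_UNIV[symmetric] Collect_neg_eq)
  ultimately show ?thesis by simp
qed

section \<open>Averages of columns as approximations\<close>

text \<open>
  The index \<open>(l, c)\<close> stands for the multiple \<open>2 \<i>\<^sup>c\<close> of column \<open>l\<close> if \<open>c < 4\<close>, and for zero if \<open>c = 4\<close>. The
  factor 2 accounts for \<open>\<bar>Re z\<bar> + \<bar>Im z\<bar> \<le> 2 \<bar>z\<bar>\<close>.
\<close>

definition dictionary :: "(nat \<Rightarrow> complex) \<Rightarrow> nat \<times> nat \<Rightarrow> complex" where
  "dictionary a = (\<lambda>(l, c). if c < 4 then 2 * \<i> ^ c * a l else 0)"

lemma sum_lessThan_5: "(\<Sum>c<5::nat. f c) = f 0 + f 1 + f 2 + f 3 + f 4"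
  by (simp add: eval_nat_numeral)

text \<open>The positive and negative parts of the real and imaginary parts of \<open>x l\<close>,
  halved against the factor 2 of the dictionary, serve as probabilities; the missing mass goes to
  the zero entries. One \<open>p\<close> serves every row \<open>a\<close>, so a single draw
  approximates all rows simultaneously.\<close>

lemma dictionary_pmf_exists:
  fixes x :: "nat \<Rightarrow> complex"
  assumes N: "0 < N" and x: "(\<Sum>l<N. cmod (x l)) \<le> 1"
  obtains p where "set_pmf p \<subseteq> {..<N} \<times> {..<5}"
    "\<And>a. measure_pmf.expectation p (dictionary a) = (\<Sum>l<N. a l * x l)"
proof -
  define rest where "rest = 1 - (\<Sum>l<N. (\<bar>Re (x l)\<bar> + \<bar>Im (x l)\<bar>) / 2)"
  define w where "w = (\<lambda>(l, c :: nat). if c = 0 then max 0 (Re (x l)) / 2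
    else if c = 1 then max 0 (Im (x l)) / 2 else if c = 2 then max 0 (- Re (x l)) / 2
    else if c = 3 then max 0 (- Im (x l)) / 2 else rest / real N)"
  have "(\<Sum>l<N. (\<bar>Re (x l)\<bar> + \<bar>Im (x l)\<bar>) / 2) \<le> (\<Sum>l<N. cmod (x l))"
  proof (rule sum_mono)
    fix l show "(\<bar>Re (x l)\<bar> + \<bar>Im (x l)\<bar>) / 2 \<le> cmod (x l)"
      using add_mono[OF abs_Re_le_cmod[of "x l"] abs_Im_le_cmod[of "x l"]] by simp
  qed
  then have rest: "0 \<le> rest" using x by (simp add: rest_def)
  have "(\<Sum>i\<in>{..<N} \<times> {..<5}. w i) = (\<Sum>l<N. \<Sum>c<5. w (l, c))"
    by (simp add: sum.cartesian_product)
  also have "\<dots> = (\<Sum>l<N. (\<bar>Re (x l)\<bar> + \<bar>Im (x l)\<bar>) / 2 + rest / real N)"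
    by (intro sum.cong) (auto simp: sum_lessThan_5 w_def max_def)
  also have "\<dots> = 1" using N by (simp add: sum.distrib rest_def)
  finally have sum: "(\<Sum>i\<in>{..<N} \<times> {..<5}. w i) = 1" .
  have "0 \<le> w i" for i using rest by (auto simp: w_def split: prod.split)
  then obtain p where p: "set_pmf p \<subseteq> {..<N} \<times> {..<5}" "\<And>i. i \<in> {..<N} \<times> {..<5} \<Longrightarrow> pmf p i = w i"
    using pmf_with_weights_exists[OF _ _ sum] by blast
  have "measure_pmf.expectation p (dictionary a) = (\<Sum>l<N. a l * x l)" for a
  proof -
    have "measure_pmf.expectation p (dictionary a) = (\<Sum>i\<in>{..<N} \<times> {..<5}. pmf p i *\<^sub>R dictionary a i)"
      using p(1) by (intro integral_measure_pmf) auto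
    also have "\<dots> = (\<Sum>i\<in>{..<N} \<times> {..<5}. w i *\<^sub>R dictionary a i)"
      by (intro sum.cong refl) (simp add: p(2))
    also have "\<dots> = (\<Sum>l<N. \<Sum>c<5. w (l, c) *\<^sub>R dictionary a (l, c))"
      by (simp add: sum.cartesian_product)
    also have "\<dots> = (\<Sum>l<N. a l * x l)"
      by (intro sum.cong refl)
        (auto simp: sum_lessThan_5 w_def dictionary_def max_def complex_eq_iff power3_eq_cube algebra_simps)
    finally show ?thesis .
  qed
  with p(1) show ?thesis by (rule that)
qed

text \<open>The family depends on the matrix and on \<open>m\<close> only, neither on the vector nor
  on the sample, which is what permits the union bound.\<close>

definition averages :: "nat \<Rightarrow> (nat \<Rightarrow> nat \<Rightarrow> complex) \<Rightarrow> nat \<Rightarrow> (nat \<Rightarrow> complex) set" where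
  "averages N A m = (\<lambda>r j. (\<Sum>t<m. dictionary (A j) (r t)) / of_nat m)
     ` ({..<m} \<rightarrow>\<^sub>E {..<N} \<times> {..<5})"

lemma finite_averages: "finite (averages N A m)"
  unfolding averages_def by (intro finite_imageI finite_PiE) auto

text \<open>The five multiples per column are absorbed by \<open>5 * N \<le> N * N\<close>.\<close>

lemma card_averages_le:
  assumes "5 \<le> N"
  shows "real (card (averages N A m)) \<le> exp (2 * real m * ln (real N))"
proof -
  have "card (averages N A m) \<le> card ({..<m} \<rightarrow>\<^sub>E {..<N} \<times> {..<5::nat})"
    unfolding averages_def by (intro card_image_le finite_PiE) auto
  also have "\<dots> = (N * 5) ^ m" by (simp add: card_PiE card_cartesian_product)
  also have "\<dots> \<le> (N * N) ^ m" using assms by (intro power_mono) auto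
  finally have "real (card (averages N A m)) \<le> real ((N * N) ^ m)" by (rule of_nat_mono)
  also have "\<dots> = exp (ln (real N)) ^ (2 * m)"
    using assms by (simp add: power_mult power2_eq_square)
  also have "\<dots> = exp (2 * real m * ln (real N))"
    by (simp add: exp_of_nat_mult[symmetric])
  finally show ?thesis .
qed

text \<open>The length \<open>3072 L 4\<^sup>n\<close> is \<open>3 L\<close> divided by the Maurey rate \<open>\<tau>\<^sup>2 / 64\<close> at \<open>\<tau> = 2\<^sup>-\<^sup>n / 4\<close>.\<close>

lemma averages_approximation:
  fixes A :: "nat \<Rightarrow> nat \<Rightarrow> complex"
  assumes N: "0 < N" and A: "\<And>j l. j < N \<Longrightarrow> l < N \<Longrightarrow> cmod (A j l) \<le> 1"
    and x: "(\<Sum>l<N. cmod (x l)) \<le> 1"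
    and \<mu>: "\<And>j. j < N \<Longrightarrow> 0 \<le> \<mu> j" and L: "0 < L"
  shows "\<exists>u \<in> averages N A (3072 * L * 4 ^ n).
    (\<Sum>j<N. \<mu> j * of_bool ((1/2) ^ n / 4 < cmod (u j - (\<Sum>l<N. A j l * x l)))) \<le> 4 * exp (- 3 * real L) * (\<Sum>j<N. \<mu> j)"
proof -
  let ?m = "3072 * L * 4 ^ n"
  obtain p where p: "set_pmf p \<subseteq> {..<N} \<times> {..<5}"
    "\<And>a. measure_pmf.expectation p (dictionary a) = (\<Sum>l<N. a l * x l)"
    using dictionary_pmf_exists[OF N x] by blast
  have "\<exists>r \<in> {..<?m} \<rightarrow>\<^sub>E set_pmf p.
     (\<Sum>j<N. \<mu> j * of_bool ((1/2) ^ n / 4 < cmod ((\<Sum>t<?m. dictionary (A j) (r t)) / of_nat ?m - (\<Sum>l<N. A j l * x l))))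
       \<le> 4 * exp (- real ?m * (((1/2) ^ n / 4)\<^sup>2 / 64)) * (\<Sum>j<N. \<mu> j)"
  proof (rule maurey_approximation)
    show "finite (set_pmf p)" using p(1) by (rule finite_subset) simp
    show "cmod (dictionary (A j) t) \<le> 2" if "t \<in> set_pmf p" "j \<in> {..<N}" for t j
      using that p(1) A[of j "fst t"] by (auto simp: dictionary_def norm_mult norm_power split: prod.split)
    show "(1/2 :: real) ^ n / 4 \<le> 1" by (simp add: power_le_one order_trans[of _ 1])
  qed (use \<mu> p(2) L in auto)
  moreover have "real ?m * (((1/2) ^ n / 4)\<^sup>2 / 64) = 3 * real L"
  proof -
    have "(4 :: real) ^ n = 2 ^ n * 2 ^ n" by (simp flip: power_mult_distrib)
    then show ?thesis by (simp add: power_one_over power2_eq_square field_simps)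
  qed
  moreover have "{..<?m} \<rightarrow>\<^sub>E set_pmf p \<subseteq> {..<?m} \<rightarrow>\<^sub>E {..<N} \<times> {..<5}"
    using p(1) by (intro PiE_mono) auto
  ultimately show ?thesis unfolding averages_def by (auto simp del: of_nat_mult)
qed

text \<open>On a good sample, every vector gets approximations that are accurate for the uniform and
  the empirical weights simultaneously, and \<open>empirical_energy_close\<close> applies.
  Randomness enters only through \<open>good_sample\<close>.\<close>

lemma prob_energy_close:
  fixes A :: "nat \<Rightarrow> nat \<Rightarrow> complex" and N :: nat
  defines "energy x j \<equiv> (cmod (\<Sum>l<N. A j l * x l))\<^sup>2"
  assumes N: "5 \<le> N" and q: "0 < q" and A: "\<And>j l. j < N \<Longrightarrow> l < N \<Longrightarrow> cmod (A j l) \<le> 1"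
    and par: "0 < L" "0 < \<delta>" "22 * \<delta> \<le> 1" "(1/2) ^ S \<le> \<delta>" "\<delta> * 2 ^ S \<le> 2" "(1/4) ^ L \<le> \<eta>"
      "128 * (real S + 1) * exp (- 3 * real L) \<le> \<eta>"
    and qbig: "18432 * real L * ln (real N) \<le> real q * (\<delta> * (\<eta> / real L) / (16 * (real S + 1)\<^sup>2))"
  shows "1 - 2 * real L * (real S + 1) * exp (- (6144 * real L * ln (real N)))
    \<le> measure_pmf.prob (Pi_pmf {..<q} d (\<lambda>_. pmf_of_set {..<N}))
        {r. (\<forall>t<q. r t < N) \<and> (\<forall>x. (\<Sum>l<N. cmod (x l)) \<le> 1 \<longrightarrow>
          \<bar>(\<Sum>t<q. energy x (r t)) / real q - (\<Sum>j<N. energy x j) / real N\<bar>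
            \<le> 10 * \<eta> + 88 * \<delta> * ((\<Sum>j<N. energy x j) / real N))}"
proof -
  let ?P = "Pi_pmf {..<q} d (\<lambda>_. pmf_of_set {..<N})"
  let ?G = "\<lambda>n. averages N A (3072 * L * 4 ^ n)"
  let ?good = "{r. good_sample L S \<delta> (\<eta> / real L) N q ?G r}"
  let ?target = "{r. (\<forall>t<q. r t < N) \<and> (\<forall>x. (\<Sum>l<N. cmod (x l)) \<le> 1 \<longrightarrow>
          \<bar>(\<Sum>t<q. energy x (r t)) / real q - (\<Sum>j<N. energy x j) / real N\<bar>
            \<le> 10 * \<eta> + 88 * \<delta> * ((\<Sum>j<N. energy x j) / real N))}"
  have N0: "0 < N" using N by simp
  have \<eta>: "0 < \<eta>" using par(6) by (rule less_le_trans[rotated]) simp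
  have lnN: "0 \<le> ln (real N)" using N by simp
  have prob_good: "1 - 2 * real L * (real S + 1) * exp (- (6144 * real L * ln (real N))) \<le> measure_pmf.prob ?P ?good"
  \<comment> \<open>Averages of length \<open>3072 * L * 4 ^ n\<close> give
    \<open>B = 2 * 3072 * L * ln N\<close>. Taking \<open>X = B\<close> makes
    \<open>2 * B + X\<close> the \<open>18432 * L * ln N\<close> of \<open>qbig\<close>.\<close>
  proof (rule prob_good_sample[where B = "6144 * real L * ln (real N)"])
    show "real (card (?G n)) \<le> exp (6144 * real L * ln (real N) * 4 ^ n)" for n
      using card_averages_le[OF N, of A "3072 * L * 4 ^ n"] by (simp add: mult_ac)
  qed (use N0 q par \<eta> lnN qbig finite_averages in auto)
  have good_target: "r \<in> ?target" if r: "r \<in> set_pmf ?P" "r \<in> ?good" for r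
  proof -
    have rN: "r t < N" if "t < q" for t
      using r(1) that N0 by (subst (asm) set_Pi_pmf) (auto simp: PiE_dflt_def lessThan_empty_iff)
    have "\<bar>(\<Sum>t<q. energy x (r t)) / real q - (\<Sum>j<N. energy x j) / real N\<bar>
            \<le> 10 * \<eta> + 88 * \<delta> * ((\<Sum>j<N. energy x j) / real N)"
      if x: "(\<Sum>l<N. cmod (x l)) \<le> 1" for x
    proof -
      define y where "y j = (\<Sum>l<N. A j l * x l)" for j
      define \<mu> where "\<mu> = (\<lambda>j::nat. 1 / real N)"
      define \<nu> where "\<nu> = empirical q r"
      \<comment> \<open>Twice the bound of \<open>averages_approximation\<close>, because
        \<open>\<mu> + \<nu>\<close> has total mass 2.\<close>
      define \<gamma> where "\<gamma> = 8 * exp (- 3 * real L)"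
      let ?b = "\<lambda>n u j. of_bool ((1/2) ^ n / 4 < cmod (u j - y j)) :: real"
      have E\<nu>: "(\<Sum>j<N. \<nu> j * h j) = (\<Sum>t<q. h (r t)) / real q" for h
        unfolding \<nu>_def using rN by (intro sum_empirical) auto
      have E\<mu>: "(\<Sum>j<N. \<mu> j * h j) = (\<Sum>j<N. h j) / real N" for h
        by (simp add: \<mu>_def sum_divide_distrib)
      have \<mu>: "0 \<le> \<mu> j" "(\<Sum>j<N. \<mu> j) = 1" for j using N0 by (auto simp: \<mu>_def)
      have \<nu>: "0 \<le> \<nu> j" "(\<Sum>j<N. \<nu> j) = 1" for j
        using E\<nu>[of "\<lambda>_. 1"] q by (auto simp: \<nu>_def empirical_def)
      \<comment> \<open>Approximating with respect to the sum of both weights makes the exceptional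
        rows light under each. The choice depends on \<open>r\<close>, which
        \<open>good_sample\<close> allows.\<close>
      have "\<exists>u \<in> ?G n. (\<Sum>j<N. (\<mu> j + \<nu> j) * ?b n u j) \<le> \<gamma>" for n
        using averages_approximation[OF N0 A x _ par(1), where \<mu> = "\<lambda>j. \<mu> j + \<nu> j" and n = n] \<mu> \<nu>
        by (simp add: \<gamma>_def y_def sum.distrib)
      then have "\<forall>n. \<exists>u. u \<in> ?G n \<and> (\<Sum>j<N. (\<mu> j + \<nu> j) * ?b n u j) \<le> \<gamma>" by blast
      from choice[OF this] obtain g where g: "g n \<in> ?G n" "(\<Sum>j<N. (\<mu> j + \<nu> j) * ?b n (g n) j) \<le> \<gamma>" for n
        by blast
      have bad: "(\<Sum>j<N. \<mu> j * ?b n (g n) j) \<le> \<gamma>" "(\<Sum>j<N. \<nu> j * ?b n (g n) j) \<le> \<gamma>" for n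
      proof -
        have "(\<Sum>j<N. (\<mu> j + \<nu> j) * ?b n (g n) j) = (\<Sum>j<N. \<mu> j * ?b n (g n) j) + (\<Sum>j<N. \<nu> j * ?b n (g n) j)"
          by (simp only: distrib_right sum.distrib)
        moreover have "0 \<le> (\<Sum>j<N. \<mu> j * ?b n (g n) j)" "0 \<le> (\<Sum>j<N. \<nu> j * ?b n (g n) j)"
          using \<mu> \<nu> by (auto intro!: sum_nonneg)
        ultimately show "(\<Sum>j<N. \<mu> j * ?b n (g n) j) \<le> \<gamma>" "(\<Sum>j<N. \<nu> j * ?b n (g n) j) \<le> \<gamma>"
          using g(2)[of n] by linarith+
      qed
      have y1: "cmod (y j) \<le> 1" if "j \<in> {..<N}" for j
      proof -
        have "cmod (y j) \<le> (\<Sum>l<N. cmod (A j l) * cmod (x l))"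
          unfolding y_def by (intro order_trans[OF norm_sum]) (simp add: norm_mult)
        also have "\<dots> \<le> (\<Sum>l<N. 1 * cmod (x l))"
          using A that by (intro sum_mono mult_right_mono) auto
        finally show ?thesis using x by simp
      qed
      have "\<bar>(\<Sum>j<N. \<nu> j * (cmod (y j))\<^sup>2) - (\<Sum>j<N. \<mu> j * (cmod (y j))\<^sup>2)\<bar>
        \<le> 10 * \<eta> + 88 * \<delta> * (\<Sum>j<N. \<mu> j * (cmod (y j))\<^sup>2)"
      proof (rule empirical_energy_close[where g = g and L = L and S = S and \<gamma> = \<gamma>])
        fix i s assume lv: "i < L" "s \<le> S"
        have "level_pred g i s \<in> (if s = 0 then {\<lambda>_. 0} else ?G (i + s - 1))"
          using g(1) by (simp add: level_pred_def)
        with r(2) lv g(1)[of "i + s"]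
        show "\<bar>(\<Sum>j<N. \<nu> j * incr i s (g (i + s) j) (level_pred g i s j))
          - (\<Sum>j<N. \<mu> j * incr i s (g (i + s) j) (level_pred g i s j))\<bar>
          \<le> (\<delta> * (1/4) ^ i * (\<Sum>j<N. \<mu> j * of_bool ((1/2) ^ Suc i < cmod (g (i + s) j)
              \<or> (1/2) ^ Suc i < cmod (level_pred g i s j))) + \<eta> / real L) / (real S + 1)"
          unfolding good_sample_def E\<mu> E\<nu> mem_Collect_eq by (intro less_imp_le) blast
      next
        show "16 * (real S + 1) * \<gamma> \<le> \<eta>" using par(7) by (simp add: \<gamma>_def algebra_simps)
        show "0 \<le> \<gamma>" by (simp add: \<gamma>_def)
      qed (use \<mu> \<nu> y1 bad par in auto)
      then show ?thesis unfolding E\<mu> E\<nu> by (simp add: energy_def y_def)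
    qed
    with rN show ?thesis by blast
  qed
  \<comment> \<open>The indices are below \<open>N\<close> only on the support, so the event is
    first cut down to it, at no cost in probability.\<close>
  have "measure_pmf.prob ?P ?good = measure_pmf.prob ?P (?good \<inter> set_pmf ?P)"
    by (simp add: measure_Int_set_pmf)
  also have "\<dots> \<le> measure_pmf.prob ?P ?target"
  proof (rule measure_pmf.finite_measure_mono)
    show "?good \<inter> set_pmf ?P \<subseteq> ?target" using good_target by blast
  qed simp
  finally show ?thesis using prob_good by linarith
qed

end

section \<open>Restricted isometries\<close>

lemma unitary_mat_column_inner:
  assumes M: "unitary_mat N M" and l: "l < N" "l' < N"
  shows "(\<Sum>j<N. cnj (M $$ (j, l)) * M $$ (j, l')) = of_bool (l = l')"
proof -
  have car: "M \<in> carrier_mat N N" and id: "mat_adjoint M * M = 1\<^sub>m N"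
    using M by (auto simp: unitary_mat_def)
  have "(mat_adjoint M * M) $$ (l, l') = row (mat_adjoint M) l \<bullet> col M l'"
    using car l by (simp add: mat_adjoint_def)
  also have "\<dots> = (\<Sum>j<N. cnj (M $$ (j, l)) * M $$ (j, l'))"
    using car l by (simp add: scalar_prod_def mat_adjoint_def atLeast0LessThan)
  finally show ?thesis unfolding id using l by (simp add: of_bool_def)
qed

lemma unitary_mat_energy:
  fixes x :: "nat \<Rightarrow> complex"
  assumes M: "unitary_mat N M"
  shows "(\<Sum>j<N. (cmod (\<Sum>l<N. M $$ (j, l) * x l))\<^sup>2) = (\<Sum>l<N. (cmod (x l))\<^sup>2)"
proof -
  have "complex_of_real (\<Sum>j<N. (cmod (\<Sum>l<N. M $$ (j, l) * x l))\<^sup>2)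
      = (\<Sum>j<N. (\<Sum>l<N. M $$ (j, l) * x l) * cnj (\<Sum>l<N. M $$ (j, l) * x l))"
    by (simp only: of_real_sum complex_norm_square)
  also have "\<dots> = (\<Sum>j<N. \<Sum>l<N. \<Sum>l'<N. (M $$ (j, l) * x l) * cnj (M $$ (j, l') * x l'))"
    by (simp only: cnj_sum sum_product)
  also have "\<dots> = (\<Sum>l<N. \<Sum>j<N. \<Sum>l'<N. (M $$ (j, l) * x l) * cnj (M $$ (j, l') * x l'))"
    by (rule sum.swap)
  also have "\<dots> = (\<Sum>l<N. \<Sum>l'<N. \<Sum>j<N. (M $$ (j, l) * x l) * cnj (M $$ (j, l') * x l'))"
    by (intro sum.cong refl sum.swap)
  also have "\<dots> = (\<Sum>l<N. \<Sum>l'<N. (\<Sum>j<N. cnj (M $$ (j, l')) * M $$ (j, l)) * (x l * cnj (x l')))"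
    unfolding sum_distrib_right by (simp add: mult_ac)
  also have "\<dots> = (\<Sum>l<N. \<Sum>l'<N. if l = l' then x l * cnj (x l') else 0)"
    by (intro sum.cong refl) (auto simp: unitary_mat_column_inner[OF M])
  also have "\<dots> = (\<Sum>l<N. x l * cnj (x l))" by (simp add: sum.delta')
  also have "\<dots> = complex_of_real (\<Sum>l<N. (cmod (x l))\<^sup>2)"
    by (simp only: of_real_sum complex_norm_square)
  finally show ?thesis by (simp only: of_real_eq_iff)
qed

lemma l2_norm_square: "(l2_norm x)\<^sup>2 = (\<Sum>i<dim_vec x. (cmod (x $ i))\<^sup>2)"
  unfolding l2_norm_def L2_set_def by (simp add: sum_nonneg)

text \<open>Cauchy-Schwarz on the support of \<open>x\<close>.\<close>

lemma sparse_l1_le: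
  assumes "sparse k x"
  shows "(\<Sum>i<dim_vec x. cmod (x $ i)) \<le> sqrt (real k) * l2_norm x"
proof -
  let ?T = "{i. i < dim_vec x \<and> x $ i \<noteq> 0}"
  have "(\<Sum>i<dim_vec x. cmod (x $ i)) = (\<Sum>i\<in>?T. cmod (x $ i))"
    by (rule sum.mono_neutral_right) auto
  also have "(\<dots>)\<^sup>2 \<le> (\<Sum>i\<in>?T. (cmod (x $ i))\<^sup>2) * real (card ?T)"
    by (rule sum_squared_le_sum_of_squares)
  also have "\<dots> \<le> (l2_norm x)\<^sup>2 * real k"
  proof (rule mult_mono)
    show "(\<Sum>i\<in>?T. (cmod (x $ i))\<^sup>2) \<le> (l2_norm x)\<^sup>2"
      unfolding l2_norm_square by (rule sum_mono2) auto
    show "real (card ?T) \<le> real k" using assms by (simp add: sparse_def)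
  qed auto
  also have "\<dots> = (sqrt (real k) * l2_norm x)\<^sup>2" by (simp add: power_mult_distrib)
  finally show ?thesis
    by (rule power2_le_imp_le) (simp add: l2_norm_def)
qed

text \<open>Dividing \<open>x\<close> by \<open>sqrt k * l2_norm x\<close> brings its l1-norm to at
  most 1 by \<open>sparse_l1_le\<close>. Unitarity makes the mean energy of the rescaled vector
  exactly \<open>1 / (k * K\<^sup>2)\<close>, so the additive and the relative part of
  \<open>close\<close> each contribute a relative error \<open>\<epsilon> / 2\<close>.\<close>

lemma restricted_isometry_scaled_row_selection:
  fixes M :: "complex mat" and K :: real and N :: nat
  defines "energy x j \<equiv> (cmod (\<Sum>l<N. of_real (sqrt (real N) / K) * M $$ (j, l) * x l))\<^sup>2"
  assumes M: "unitary_mat N M" and N: "0 < N" and q: "0 < q" and k: "0 < k" and K: "0 < K"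
    and r: "\<And>t. t < q \<Longrightarrow> r t < N"
    and close: "\<And>x. (\<Sum>l<N. cmod (x l)) \<le> 1 \<Longrightarrow>
      \<bar>(\<Sum>t<q. energy x (r t)) / real q - (\<Sum>j<N. energy x j) / real N\<bar>
        \<le> \<epsilon> / (2 * real k * K\<^sup>2) + \<epsilon> / 2 * ((\<Sum>j<N. energy x j) / real N)"
  shows "restricted_isometry k \<epsilon> (scaled_row_selection q M r)"
  unfolding restricted_isometry_def
proof (intro ballI impI)
  let ?A = "scaled_row_selection q M r"
  fix x assume x: "x \<in> carrier_vec (dim_col ?A)" and sp: "sparse k x"
  have dimM: "dim_row M = N" "dim_col M = N" using M by (auto simp: unitary_mat_def)
  then have dx: "dim_vec x = N" using x by (simp add: scaled_row_selection_def)
  define n where "n = (l2_norm x)\<^sup>2"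
  define z where "z j = (\<Sum>l<N. M $$ (j, l) * x $ l)" for j
  have n: "n = (\<Sum>l<N. (cmod (x $ l))\<^sup>2)" by (simp add: n_def l2_norm_square dx)
  have En: "(\<Sum>j<N. (cmod (z j))\<^sup>2) = n" unfolding z_def n by (rule unitary_mat_energy[OF M])
  have Ax: "(l2_norm (?A *\<^sub>v x))\<^sup>2 = real N / real q * (\<Sum>t<q. (cmod (z (r t)))\<^sup>2)"
  proof -
    have "(?A *\<^sub>v x) $ t = of_real (sqrt (real N / real q)) * z (r t)" if "t < q" for t
      using that dx r[OF that] by (simp add: scaled_row_selection_def scalar_prod_def dimM z_def sum_distrib_left
          atLeast0LessThan mult.assoc)
    then show ?thesis
      unfolding l2_norm_square
      by (simp add: scaled_row_selection_def norm_mult power_mult_distrib sum_distrib_left)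
  qed
  have "\<bar>(l2_norm (?A *\<^sub>v x))\<^sup>2 - n\<bar> \<le> \<epsilon> * n"
  \<comment> \<open>The zero vector cannot be normalised.\<close>
  proof (cases "n = 0")
    case True
    then have "x $ l = 0" if "l < N" for l
      using that unfolding n by (subst (asm) sum_nonneg_eq_0_iff) auto
    then have "z j = 0" for j unfolding z_def by simp
    then show ?thesis unfolding Ax by (simp add: True)
  next
    case False
    then have n0: "0 < n" by (simp add: n_def)
    define s where "s = sqrt (real k) * l2_norm x"
    have s: "0 < s" "s\<^sup>2 = real k * n"
      using n0 k unfolding s_def n_def by (auto simp: l2_norm_def power_mult_distrib intro!: mult_pos_pos)
       (smt (verit) L2_set_nonneg)
    define x' where "x' l = x $ l / of_real s" for l
    have "(\<Sum>l<N. cmod (x' l)) = (\<Sum>l<N. cmod (x $ l)) / s"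
      using s by (simp add: x'_def norm_divide sum_divide_distrib)
    also have "\<dots> \<le> 1" using s sparse_l1_le[OF sp] by (simp add: dx s_def)
    finally have le1: "(\<Sum>l<N. cmod (x' l)) \<le> 1" .
    have energy: "energy x' j = real N * (cmod (z j))\<^sup>2 / (K\<^sup>2 * real k * n)" for j
    proof -
      have "(\<Sum>l<N. of_real (sqrt (real N) / K) * M $$ (j, l) * x' l) = of_real (sqrt (real N) / K / s) * z j"
        by (simp add: z_def x'_def sum_distrib_left field_simps)
      then show ?thesis
        using K s by (simp add: energy_def norm_mult norm_divide power_mult_distrib power_divide mult.assoc)
    qed
    define e where "e = 1 / (real k * K\<^sup>2)"
    have e: "0 < e" using k K by (simp add: e_def)
    have eN: "(\<Sum>j<N. energy x' j) / real N = e"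
      using N n0 En by (simp add: energy e_def sum_divide_distrib[symmetric] sum_distrib_left[symmetric] mult_ac)
    have eq: "(\<Sum>t<q. energy x' (r t)) / real q = e * ((l2_norm (?A *\<^sub>v x))\<^sup>2 / n)"
      unfolding Ax by (simp add: energy e_def sum_divide_distrib[symmetric] sum_distrib_left[symmetric] mult_ac)
    have "e * \<bar>(l2_norm (?A *\<^sub>v x))\<^sup>2 / n - 1\<bar> = \<bar>e * ((l2_norm (?A *\<^sub>v x))\<^sup>2 / n) - e\<bar>"
    proof -
      have "e * a - e = e * (a - 1)" for a by (simp add: algebra_simps)
      then show ?thesis using e by (simp only: abs_mult abs_of_pos)
    qed
    also have "\<dots> \<le> e * \<epsilon>"
      using close[OF le1] unfolding eN eq by (simp add: e_def field_simps)
    finally have "\<bar>(l2_norm (?A *\<^sub>v x))\<^sup>2 / n - 1\<bar> \<le> \<epsilon>" using e by simp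
    then have "n * \<bar>(l2_norm (?A *\<^sub>v x))\<^sup>2 / n - 1\<bar> \<le> n * \<epsilon>" using n0 by simp
    moreover have "n * \<bar>(l2_norm (?A *\<^sub>v x))\<^sup>2 / n - 1\<bar> = \<bar>(l2_norm (?A *\<^sub>v x))\<^sup>2 - n\<bar>"
      using n0 by (simp add: abs_if field_simps)
    ultimately show ?thesis by (simp add: mult.commute)
  qed
  then show "(1 - \<epsilon>) * (l2_norm x)\<^sup>2 \<le> (l2_norm (?A *\<^sub>v x))\<^sup>2 \<and>
        (l2_norm (?A *\<^sub>v x))\<^sup>2 \<le> (1 + \<epsilon>) * (l2_norm x)\<^sup>2"
    unfolding n_def[symmetric] by (simp add: abs_le_iff algebra_simps)
qed

text \<open>The choice \<open>\<delta> = \<epsilon> / 176\<close> turns \<open>88 * \<delta>\<close>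
  into \<open>\<epsilon> / 2\<close>, and the value of \<open>\<eta>\<close> turns
  \<open>10 * \<eta>\<close> into \<open>\<epsilon> / (2 * k * K\<^sup>2)\<close>. Flatness gives
  entries of modulus at most 1 after scaling by \<open>sqrt N / K\<close>.\<close>

lemma prob_restricted_isometry:
  fixes M :: "complex mat" and K :: real
  assumes M: "unitary_mat N M" and N: "5 \<le> N" and q: "0 < q" and k: "0 < k" and K: "0 < K"
    and flat: "\<And>i j. i < N \<Longrightarrow> j < N \<Longrightarrow> cmod (M $$ (i, j)) \<le> K / sqrt (real N)"
    and \<epsilon>: "0 < \<epsilon>" "\<epsilon> \<le> 1" and L: "0 < L"
    and S: "(1/2) ^ S \<le> \<epsilon> / 176" "\<epsilon> / 176 * 2 ^ S \<le> 2"
    and \<eta>: "\<eta> = \<epsilon> / (20 * real k * K\<^sup>2)" "(1/4) ^ L \<le> \<eta>" "128 * (real S + 1) * exp (- 3 * real L) \<le> \<eta>"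
    and qbig: "18432 * real L * ln (real N) \<le> real q * (\<epsilon> / 176 * (\<eta> / real L) / (16 * (real S + 1)\<^sup>2))"
  shows "1 - 2 * real L * (real S + 1) * exp (- (6144 * real L * ln (real N)))
    \<le> measure_pmf.prob (subsampled_mat_pmf q M) {A. restricted_isometry k \<epsilon> A}"
proof -
  let ?A = "\<lambda>j l. of_real (sqrt (real N) / K) * M $$ (j, l)"
  let ?P = "Pi_pmf {..<q} 0 (\<lambda>_. pmf_of_set {..<N})"
  let ?en = "\<lambda>x j. (cmod (\<Sum>l<N. ?A j l * x l))\<^sup>2"
  let ?target = "{r. (\<forall>t<q. r t < N) \<and> (\<forall>x. (\<Sum>l<N. cmod (x l)) \<le> 1 \<longrightarrow>
          \<bar>(\<Sum>t<q. ?en x (r t)) / real q - (\<Sum>j<N. ?en x j) / real N\<bar>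
            \<le> 10 * \<eta> + 88 * (\<epsilon> / 176) * ((\<Sum>j<N. ?en x j) / real N))}"
  have dimM: "dim_row M = N" using M by (auto simp: unitary_mat_def)
  have A1: "cmod (?A j l) \<le> 1" if "j < N" "l < N" for j l
  proof -
    have "cmod (?A j l) = sqrt (real N) / K * cmod (M $$ (j, l))"
      using K by (simp add: norm_mult norm_divide)
    also have "\<dots> \<le> sqrt (real N) / K * (K / sqrt (real N))"
      using flat[OF that] K by (intro mult_left_mono) auto
    also have "\<dots> = 1" using K N by simp
    finally show ?thesis .
  qed
  have "1 - 2 * real L * (real S + 1) * exp (- (6144 * real L * ln (real N)))
    \<le> measure_pmf.prob ?P ?target"
    by (rule prob_energy_close) (use N q L \<epsilon> S \<eta>(2,3) qbig A1 in auto)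
  also have "\<dots> \<le> measure_pmf.prob ?P (scaled_row_selection q M -` {A. restricted_isometry k \<epsilon> A})"
  proof (rule measure_pmf.finite_measure_mono)
    show "?target \<subseteq> scaled_row_selection q M -` {A. restricted_isometry k \<epsilon> A}"
    proof (rule subsetI)
      fix r assume r: "r \<in> ?target"
      have "restricted_isometry k \<epsilon> (scaled_row_selection q M r)"
      proof (rule restricted_isometry_scaled_row_selection[OF M _ q k K])
        show "0 < N" using N by simp
        show "r t < N" if "t < q" for t using r that by blast
        fix x :: "nat \<Rightarrow> complex" assume "(\<Sum>l<N. cmod (x l)) \<le> 1"
        then have "\<bar>(\<Sum>t<q. ?en x (r t)) / real q - (\<Sum>j<N. ?en x j) / real N\<bar>
            \<le> 10 * \<eta> + 88 * (\<epsilon> / 176) * ((\<Sum>j<N. ?en x j) / real N)" using r by blast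
        moreover have "10 * \<eta> = \<epsilon> / (2 * real k * K\<^sup>2)" by (simp add: \<eta>(1))
        ultimately show "\<bar>(\<Sum>t<q. ?en x (r t)) / real q - (\<Sum>j<N. ?en x j) / real N\<bar>
            \<le> \<epsilon> / (2 * real k * K\<^sup>2) + \<epsilon> / 2 * ((\<Sum>j<N. ?en x j) / real N)" by simp
      qed
      then show "r \<in> scaled_row_selection q M -` {A. restricted_isometry k \<epsilon> A}" by simp
    qed
  qed simp
  also have "\<dots> = measure_pmf.prob (subsampled_mat_pmf q M) {A. restricted_isometry k \<epsilon> A}"
    by (simp add: subsampled_mat_pmf_def dimM)
  finally show ?thesis .
qed

section \<open>Choice of the parameters\<close>

lemma two_power_le_exp: "2 ^ n \<le> exp (real n)"
proof -
  have "(2 :: real) \<le> exp 1" using exp_ge_add_one_self[of 1] by simp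
  then have "(2 :: real) ^ n \<le> exp 1 ^ n" by (rule power_mono) simp
  then show ?thesis by (simp flip: exp_of_nat_mult)
qed

lemma log2_ceiling_bounds:
  fixes a :: real
  assumes "1 \<le> a"
  defines "n \<equiv> nat \<lceil>log 2 a\<rceil>"
  shows "a \<le> 2 ^ n" "2 ^ n \<le> 2 * a" "log 2 a \<le> real n" "real n \<le> log 2 a + 1"
proof -
  have l: "0 \<le> log 2 a" using assms by simp
  then have n: "real n = of_int \<lceil>log 2 a\<rceil>" by (simp add: n_def)
  show n1: "log 2 a \<le> real n" and n2: "real n \<le> log 2 a + 1" unfolding n by linarith+
  have p: "a = 2 powr (log 2 a)" "2 * a = 2 powr (log 2 a + 1)" using assms by (simp_all add: powr_add)
  show "a \<le> 2 ^ n" using n1 by (subst p(1)) (simp add: powr_realpow[symmetric])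
  show "2 ^ n \<le> 2 * a" using n2 by (subst p(2)) (simp add: powr_realpow[symmetric])
qed

theorem theorem4p5:
  fixes K :: real
  assumes "K > 0"
  shows "\<exists>(N\<^sub>0::nat) (k\<^sub>0::nat) (\<epsilon>\<^sub>0::real) (C::real) (c::real).
    N\<^sub>0 > 0 \<and> k\<^sub>0 > 0 \<and> \<epsilon>\<^sub>0 > 0 \<and> C > 0 \<and> c > 0 \<and>
    (\<forall>(N::nat) (k::nat) (\<epsilon>::real) (M::complex mat).
      N \<ge> N\<^sub>0 \<longrightarrow> k \<ge> k\<^sub>0 \<longrightarrow> 0 < \<epsilon> \<longrightarrow> \<epsilon> \<le> \<epsilon>\<^sub>0 \<longrightarrow>
      unitary_mat N M \<longrightarrow>
      (\<forall>i<N. \<forall>j<N. cmod (M $$ (i, j)) \<le> K / sqrt (real N)) \<longrightarrow>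
      (\<exists>q::nat. q > 0 \<and>
        real q \<le> C * (log 2 (1 / \<epsilon>))\<^sup>2 * (1 / \<epsilon>\<^sup>2) * real k
                   * (log 2 (real k / \<epsilon>))\<^sup>2 * log 2 (real N) \<and>
        measure_pmf.prob (subsampled_mat_pmf q M) {A. restricted_isometry k \<epsilon> A}
          \<ge> 1 - 2 powr (- c * log 2 (real N) * log 2 (real k / \<epsilon>))))"
proof -
  \<comment> \<open>Enlarging \<open>K\<close> preserves the flatness bound and provides
    \<open>1 \<le> K'\<^sup>2\<close>.\<close>
  define K' where "K' = max 1 K"
  have K': "1 \<le> K'" "K \<le> K'" by (auto simp: K'_def)
  \<comment> \<open>Lets \<open>k\<close> absorb multiples of \<open>K'\<^sup>2\<close>; the largest
    one needed is 901120, in the proof of \<open>\<eta>S\<close>.\<close>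
  define k\<^sub>0 where "k\<^sub>0 = nat \<lceil>1000000 * K'\<^sup>2\<rceil>"
  \<comment> \<open>The factors 18432, 16, 176 and 20 come from solving the sampling condition for
    \<open>q\<close>, 64 from \<open>real S + 1 \<le> 4 * h\<close> and
    \<open>real L \<le> 2 * lk\<close>, and 2 from rounding up to an integer.\<close>
  define C where "C = 2 * 18432 * 16 * 176 * 20 * 64 * K'\<^sup>2"
  have k\<^sub>0: "1000000 * K'\<^sup>2 \<le> real k\<^sub>0" unfolding k\<^sub>0_def by (rule real_nat_ceiling_ge)
  have K'2: "1 \<le> K'\<^sup>2" using K' by (simp add: one_le_power)
  have main: "\<exists>q>0. real q \<le> C * (log 2 (1 / \<epsilon>))\<^sup>2 * (1 / \<epsilon>\<^sup>2) * real k
                   * (log 2 (real k / \<epsilon>))\<^sup>2 * log 2 (real N) \<and>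
        measure_pmf.prob (subsampled_mat_pmf q M) {A. restricted_isometry k \<epsilon> A}
          \<ge> 1 - 2 powr (- 1 * log 2 (real N) * log 2 (real k / \<epsilon>))"
    if N: "5 \<le> N" and k: "k\<^sub>0 \<le> k" and \<epsilon>: "0 < \<epsilon>" "\<epsilon> \<le> 1 / 200" and M: "unitary_mat N M"
      and flat: "\<forall>i<N. \<forall>j<N. cmod (M $$ (i, j)) \<le> K / sqrt (real N)"
    for N k :: nat and \<epsilon> :: real and M :: "complex mat"
  proof -
    have kK: "1000000 * K'\<^sup>2 \<le> real k" using k\<^sub>0 k by linarith
    then have k1: "1000000 \<le> real k" using K'2 by linarith
    define lk where "lk = log 2 (real k / \<epsilon>)"
    define h where "h = log 2 (1 / \<epsilon>)"
    \<comment> \<open>With \<open>2 ^ L\<close> at least \<open>k / \<epsilon>\<close>, both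
      \<open>(1/4) ^ L\<close> and the weight of the exceptional rows fall below
      \<open>\<eta>\<close>.\<close>
    define L where "L = nat \<lceil>lk\<rceil>"
    \<comment> \<open>Here \<open>2 ^ S\<close> lies between \<open>1 / \<delta>\<close> and
      \<open>2 / \<delta>\<close> for \<open>\<delta> = \<epsilon> / 176\<close>, as the two
      conditions on \<open>S\<close> require.\<close>
    define S where "S = nat \<lceil>log 2 (176 / \<epsilon>)\<rceil>"
    define \<eta> where "\<eta> = \<epsilon> / (20 * real k * K'\<^sup>2)"
    \<comment> \<open>The concentration rate per sampled row; \<open>Y\<close> is the real solution
      of the sampling condition, with equality.\<close>
    define \<kappa> where "\<kappa> = \<epsilon> / 176 * (\<eta> / real L) / (16 * (real S + 1)\<^sup>2)"
    define Y where "Y = 18432 * real L * ln (real N) / \<kappa>"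
    define q where "q = nat \<lceil>Y\<rceil>"
    have ke: "2 \<le> real k / \<epsilon>" using \<epsilon> k1 by (simp add: le_divide_eq)
    then have lk1: "1 \<le> lk" unfolding lk_def by (simp add: le_log_iff)
    have L: "real k / \<epsilon> \<le> 2 ^ L" "lk \<le> real L" "real L \<le> 2 * lk"
      using log2_ceiling_bounds[of "real k / \<epsilon>"] ke lk1 unfolding L_def lk_def by linarith+
    have L1: "1 \<le> real L" using L(2) lk1 by linarith
    have S: "176 / \<epsilon> \<le> 2 ^ S" "2 ^ S \<le> 2 * (176 / \<epsilon>)" "real S \<le> log 2 (176 / \<epsilon>) + 1"
      using log2_ceiling_bounds[of "176 / \<epsilon>"] \<epsilon> unfolding S_def by (auto simp: le_divide_eq)
    have S1: "real S + 1 \<le> 352 / \<epsilon>"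
    proof -
      have "S + 1 \<le> 2 ^ S" by (simp add: Suc_leI less_exp)
      then have "real (S + 1) \<le> real (2 ^ S)" by (rule of_nat_mono)
      then show ?thesis using S(2) by simp
    qed
    have Sh: "real S + 1 \<le> 4 * h"
    proof -
      \<comment> \<open>The factor 4 pays for the two units by which \<open>real S + 1\<close> may
        exceed \<open>log 2 (176 / \<epsilon>)\<close>. The claim amounts to
        \<open>704 * \<epsilon> ^ 3 \<le> 1\<close>, which the bound \<open>1 / 200\<close> on
        \<open>\<epsilon>\<close> ensures.\<close>
      have "176 / \<epsilon> * 4 \<le> (1 / \<epsilon>) ^ 4"
      proof -
        have "\<epsilon> ^ 3 \<le> (1/200) ^ 3" using \<epsilon> by (intro power_mono) auto
        also have "(1/200 :: real) ^ 3 \<le> 1 / 704" by (simp add: power3_eq_cube)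
        finally have "704 * \<epsilon> ^ 3 \<le> 1" by simp
        then show ?thesis using \<epsilon> by (simp add: field_simps power4_eq_xxxx power3_eq_cube)
      qed
      then have "log 2 (176 / \<epsilon> * 4) \<le> log 2 ((1 / \<epsilon>) ^ 4)" using \<epsilon> by simp
      also have "\<dots> = 4 * h" unfolding h_def using \<epsilon> by (subst log_nat_power) auto
      also have "log 2 (176 / \<epsilon> * 4) = log 2 (176 / \<epsilon>) + 2"
      proof -
        have "log 2 (4 :: real) = 2" using log_nat_power[of 2 2 2] by simp
        then show ?thesis using \<epsilon> by (subst log_mult) auto
      qed
      finally show ?thesis using S(3) by linarith
    qed
    have pos: "0 < K'" "0 < real k" using K' k1 by linarith+
    have \<eta>0: "0 < \<eta>" unfolding \<eta>_def using \<epsilon> pos by (intro divide_pos_pos mult_pos_pos) auto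
    have half_L: "(1/2) ^ L \<le> \<epsilon> / real k"
    proof -
      have "0 < real k / \<epsilon>" using ke by linarith
      then have "1 / 2 ^ L \<le> 1 / (real k / \<epsilon>)" using L(1) by (intro divide_left_mono mult_pos_pos) auto
      then show ?thesis by (simp add: power_one_over)
    qed
    have \<eta>L: "(1/4) ^ L \<le> \<eta>"
    proof -
      have "(1/4 :: real) ^ L = ((1/2) ^ L)\<^sup>2" by (simp add: power2_eq_square flip: power_mult_distrib)
      also have "\<dots> \<le> (\<epsilon> / real k)\<^sup>2" using half_L by (rule power_mono) simp
      also have "\<dots> \<le> \<eta>"
      proof -
        have "\<epsilon> * (20 * K'\<^sup>2) \<le> 1 * real k"
          using \<epsilon> kK by (intro mult_mono) auto
        then have "\<epsilon> * (\<epsilon> * (20 * K'\<^sup>2)) \<le> \<epsilon> * real k" using \<epsilon> by simp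
        then show ?thesis using pos by (simp add: \<eta>_def power2_eq_square field_simps)
      qed
      finally show ?thesis .
    qed
    \<comment> \<open>The exponent 3 leaves room: the cube of \<open>\<epsilon> / k\<close>
      outweighs the factor \<open>352 / \<epsilon>\<close> bounding \<open>real S + 1\<close> and
      still falls below \<open>\<eta>\<close>, which is of order
      \<open>\<epsilon> / k\<close>.\<close>
    have \<eta>S: "128 * (real S + 1) * exp (- 3 * real L) \<le> \<eta>"
    proof -
      have "exp (- 3 * real L) = 1 / exp (real (3 * L))" by (simp add: exp_minus divide_inverse)
      also have "\<dots> \<le> 1 / 2 ^ (3 * L)" by (intro divide_left_mono two_power_le_exp) auto
      also have "\<dots> = (1/2) ^ (3 * L)" by (simp add: power_one_over)
      also have "\<dots> = ((1/2) ^ L) ^ 3" by (simp add: power_mult[symmetric] mult.commute)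
      also have "\<dots> \<le> (\<epsilon> / real k) ^ 3" using half_L by (rule power_mono) simp
      finally have "128 * (real S + 1) * exp (- 3 * real L) \<le> 128 * (352 / \<epsilon>) * (\<epsilon> / real k) ^ 3"
        using S1 \<epsilon> by (intro mult_mono) auto
      also have "\<dots> = 45056 * \<epsilon>\<^sup>2 / real k ^ 3"
        using \<epsilon> by (simp add: power3_eq_cube power2_eq_square)
      also have "\<dots> \<le> \<eta>"
      proof -
        have "\<epsilon> * (901120 * K'\<^sup>2) \<le> 1 * real k" using \<epsilon> kK by (intro mult_mono) auto
        also have "\<dots> \<le> real k * real k" using k1 by simp
        finally have "\<epsilon> * (\<epsilon> * (901120 * K'\<^sup>2)) \<le> \<epsilon> * (real k * real k)"
          using \<epsilon> by (intro mult_left_mono) auto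
        then show ?thesis using pos
          by (simp add: \<eta>_def power2_eq_square power3_eq_cube field_simps)
      qed
      finally show ?thesis .
    qed
    have lnN: "1 \<le> ln (real N)"
    proof -
      have "exp 1 \<le> real N" using exp_le N by linarith
      then show ?thesis using N by (simp add: ln_ge_iff)
    qed
    have \<kappa>0: "0 < \<kappa>" unfolding \<kappa>_def using \<epsilon> \<eta>0 L1
      by (intro divide_pos_pos mult_pos_pos) auto
    have Y: "Y = 18432 * 16 * 176 * 20 * K'\<^sup>2 * (real S + 1)\<^sup>2 * (1 / \<epsilon>\<^sup>2) * real k * (real L)\<^sup>2 * ln (real N)"
      using \<epsilon> L1 pos by (simp add: Y_def \<kappa>_def \<eta>_def power2_eq_square)
    have \<kappa>1: "\<kappa> \<le> 1"
    proof -
      have "\<eta> \<le> 1" unfolding \<eta>_def using \<epsilon> k1 K'2 mult_mono[of 1 "20 * real k" 1 "K'\<^sup>2"]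
        by (simp add: divide_le_eq)
      then have "\<epsilon> / 176 * (\<eta> / real L) \<le> 1 * 1"
        using \<epsilon> \<eta>0 L1 by (intro mult_mono) (auto simp: divide_le_eq)
      moreover have "1 \<le> 16 * (real S + 1)\<^sup>2" using one_le_power[of "real S + 1" 2] by linarith
      ultimately show ?thesis unfolding \<kappa>_def by (intro mult_imp_div_pos_le) linarith+
    qed
    have Y1: "1 \<le> Y"
    proof -
      have "1 * 1 \<le> real L * ln (real N)" using L1 lnN by (intro mult_mono) auto
      then have "\<kappa> \<le> 18432 * real L * ln (real N)" using \<kappa>1 by linarith
      then show ?thesis using \<kappa>0 by (simp add: Y_def le_divide_eq)
    qed
    \<comment> \<open>Rounding up at most doubles \<open>Y\<close> because
      \<open>1 \<le> Y\<close>.\<close>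
    have q: "Y \<le> real q" "real q \<le> 2 * Y" "0 < q" using Y1 unfolding q_def by linarith+
    have size: "real q \<le> C * h\<^sup>2 * (1 / \<epsilon>\<^sup>2) * real k * lk\<^sup>2 * log 2 (real N)"
    proof -
      have "(real S + 1)\<^sup>2 \<le> (4 * h)\<^sup>2" "(real L)\<^sup>2 \<le> (2 * lk)\<^sup>2"
        by (rule power_mono[OF Sh], simp) (rule power_mono[OF L(3)], simp)
      moreover have "ln (real N) \<le> log 2 (real N)"
        using lnN ln2_le_25_over_36 ln_2_less_1 by (simp add: log_def le_divide_eq mult_left_le)
      ultimately have "Y \<le> 18432 * 16 * 176 * 20 * K'\<^sup>2 * (4 * h)\<^sup>2 * (1 / \<epsilon>\<^sup>2) * real k * (2 * lk)\<^sup>2 * log 2 (real N)"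
        unfolding Y using lnN by (intro mult_mono mult_nonneg_nonneg) auto
      also have "2 * \<dots> = C * h\<^sup>2 * (1 / \<epsilon>\<^sup>2) * real k * lk\<^sup>2 * log 2 (real N)"
        by (simp add: C_def power_mult_distrib)
      finally show ?thesis using q(2) by linarith
    qed
    have "1 - 2 * real L * (real S + 1) * exp (- (6144 * real L * ln (real N)))
      \<le> measure_pmf.prob (subsampled_mat_pmf q M) {A. restricted_isometry k \<epsilon> A}"
    proof (rule prob_restricted_isometry[where K = K' and \<eta> = \<eta>])
      show "cmod (M $$ (i, j)) \<le> K' / sqrt (real N)" if "i < N" "j < N" for i j
        using flat that K' by (meson divide_right_mono order_trans real_sqrt_ge_zero of_nat_0_le_iff)
      show "(1/2) ^ S \<le> \<epsilon> / 176"
        using S(1) \<epsilon> by (simp add: power_one_over field_simps)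
      show "\<epsilon> / 176 * 2 ^ S \<le> 2" using S(2) \<epsilon> by (simp add: field_simps)
      show "18432 * real L * ln (real N) \<le> real q * (\<epsilon> / 176 * (\<eta> / real L) / (16 * (real S + 1)\<^sup>2))"
        using q(1) \<kappa>0 unfolding \<kappa>_def[symmetric] Y_def by (simp add: divide_le_eq)
    qed (use M N q k1 K' \<epsilon> L1 \<eta>L \<eta>S in \<open>auto simp: \<eta>_def\<close>)
    \<comment> \<open>Of the 6144 units in the exponent, 6143 absorb the prefactor, which is at most
      \<open>2 ^ (10 + 2 * L)\<close>. The remaining one yields the claimed probability with
      \<open>c = 1\<close>, as \<open>lk \<le> real L\<close>.\<close>
    moreover have "2 * real L * (real S + 1) * exp (- (6144 * real L * ln (real N)))
        \<le> 2 powr (- 1 * log 2 (real N) * lk)"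
    proof -
      have "real L \<le> 2 ^ L" using less_exp[of L] by (metis less_imp_le of_nat_le_iff of_nat_numeral of_nat_power)
      moreover have "real S + 1 \<le> 352 * 2 ^ L"
      proof -
        have "352 / \<epsilon> \<le> 352 * (real k / \<epsilon>)" using \<epsilon> k1 by (simp add: field_simps)
        then show ?thesis using S1 L(1) by linarith
      qed
      ultimately have "2 * real L * (real S + 1) \<le> 2 * 2 ^ L * (352 * 2 ^ L)"
        by (intro mult_mono) auto
      also have "\<dots> \<le> 2 ^ (10 + 2 * L)"
      proof -
        have "(2 :: real) ^ (10 + 2 * L) = 1024 * (2 ^ L * 2 ^ L)"
          unfolding power_add mult_2 by simp
        moreover have "2 * 2 ^ L * (352 * 2 ^ L) = 704 * (2 ^ L * 2 ^ L :: real)" by simp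
        moreover have "0 \<le> (2 ^ L * 2 ^ L :: real)" by simp
        ultimately show ?thesis by linarith
      qed
      also have "\<dots> \<le> exp (real (10 + 2 * L))" by (rule two_power_le_exp)
      also have "\<dots> \<le> exp (6143 * real L * ln (real N))"
      proof -
        have "real L * 1 \<le> real L * ln (real N)" using lnN by (intro mult_left_mono) auto
        then have "real (10 + 2 * L) \<le> 6143 * (real L * ln (real N))"
          using L1 unfolding of_nat_add of_nat_mult of_nat_numeral by linarith
        then show ?thesis by (simp only: exp_le_cancel_iff mult.assoc)
      qed
      finally have "2 * real L * (real S + 1) * exp (- (6144 * real L * ln (real N)))
          \<le> exp (6143 * real L * ln (real N)) * exp (- (6144 * real L * ln (real N)))"
        by (rule mult_right_mono) simp
      also have "\<dots> = exp (- (real L * ln (real N)))" by (simp flip: exp_add)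
      also have "\<dots> \<le> exp (- (lk * ln (real N)))"
        using L(2) lnN by (simp add: mult_right_mono)
      also have "\<dots> = 2 powr (- 1 * log 2 (real N) * lk)" by (simp add: powr_def log_def)
      finally show ?thesis .
    qed
    ultimately show ?thesis using size q(3) unfolding h_def lk_def by (intro exI[of _ q]) auto
  qed
  have "0 < real k\<^sub>0" using k\<^sub>0 K'2 by linarith
  moreover have "0 < K'" using K'(1) by linarith
  then have "0 < C" by (simp add: C_def)
  ultimately show ?thesis using main
    by (intro exI[of _ "5 :: nat"] exI[of _ k\<^sub>0] exI[of _ "1 / 200 :: real"] exI[of _ C] exI[of _ "1 :: real"]) simp
qed

end
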